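(* Let $m\in\mathbb{N}$, let $G_m=(V_m,E_m)$ be the directed graph with vertex set $V_m=\{v_{i,j}: 1\le i\le m,\ j\ge 1\}\cong[1,2,\dots,m]\times\mathbb{N}$ whose edges are exactly $v_{i,j}\to v_{i,j+1}$ ($1\le i\le m$, $j\ge1$) and $v_{i,j}\to v_{i+1,j}$ ($1\le i\le m-1$, $j\ge 1$), and let $\mu=(\mu_v)_{v\in V_m}$ be a weight on $V_m$. Let $B$ be the backward shift on $G_m$, and let $X$ be any of the spaces $\ell^p(V_m,\mu)$, $1\le p<\infty$, or $c_0(V_m,\mu)$. Assume that $B$ is bounded on $X$. Then the following are equivalent: (i) $B$ is hypercyclic on $X$; (ii) $B$ is weakly mixing on $X$; (iii) there exists an increasing sequence $(n_k)$ of positive integers such that for any $1\le i\le m$ and $j\ge 1$, $$n_k^{m-i}\,|\mu_{v_{i,j+n_k}}|\to 0,\qquad k\to\infty;$$ (iv) there exists an increasing sequence $(n_k)$ of positive integers such that for any $1\le i\le m$, $$n_k^{m-i}\,|\mu_{v_{i,n_k}}|\to 0,\qquad k\to\infty.$$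
   Context: Here $\mathbb{N}=\{1,2,3,\dots\}$; increasing sequences are strictly increasing. For a directed graph $G=(V,E)$ with countable vertex set $V$ and edge set $E\subset V\times V$, write $v\to u$ if $(v,u)\in E$, and $Chi(v)=\{u\in V: v\to u\}$ (assumed finite for each $v$). The (unweighted) backward shift acts on functions $f:V\to\mathbb{C}$ by $$(Bf)(v)=\sum_{u\in Chi(v)} f(u),\qquad v\in V.$$ A weight on $V$ is a family $\mu=(\mu_v)_{v\in V}$ of non-zero (real or complex) numbers. For $1\le p<\infty$, $$\ell^p(V,\mu)=\Big\{f:V\to\mathbb{C}:\ \|f\|^p=\sum_{v\in V}|f(v)\mu_v|^p<\infty\Big\},$$ and $c_0(V,\mu)$ is the space of $f:V\to\mathbb{C}$ such that for every $\varepsilon>0$ there is a finite $F\subset V$ with $|f(v)\mu_v|<\varepsilon$ for $v\in V\setminus F$, with norm $\|f\|=\sup_{v\in V}|f(v)\mu_v|$. "$B$ is bounded on $X$" means that $B$ maps $X$ into $X$ and is a bounded linear operator on $X$. A continuous linear operator $T$ on a separable Banach space $X$ is hypercyclic if there exists $x\in X$ such that $\{T^nx: n\ge 0\}$ is dense in $X$; it is weakly mixing if $T\oplus T$ is hypercyclic on $X\oplus X$. *)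

theory Defs
  imports "HOL-Analysis.Analysis"
begin

section \<open>Weighted sequence spaces\<close>

text \<open>
  A function on a vertex set \<open>V\<close> is a total function that vanishes outside \<open>V\<close>; this gives every
  function from \<open>V\<close> to the complex numbers a unique representative.
\<close>

definition funs_on :: "'v set \<Rightarrow> ('v \<Rightarrow> complex) set" where
  "funs_on V = {f. \<forall>v. v \<notin> V \<longrightarrow> f v = 0}"

definition weight_on :: "'v set \<Rightarrow> ('v \<Rightarrow> complex) \<Rightarrow> bool" where
  "weight_on V \<mu> \<longleftrightarrow> (\<forall>v\<in>V. \<mu> v \<noteq> 0)"

definition lp_space :: "real \<Rightarrow> 'v set \<Rightarrow> ('v \<Rightarrow> complex) \<Rightarrow> ('v \<Rightarrow> complex) set" where
  "lp_space p V \<mu> = {f \<in> funs_on V. (\<lambda>v. norm (f v * \<mu> v) powr p) summable_on V}"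

definition lp_norm :: "real \<Rightarrow> 'v set \<Rightarrow> ('v \<Rightarrow> complex) \<Rightarrow> ('v \<Rightarrow> complex) \<Rightarrow> real" where
  "lp_norm p V \<mu> f = (\<Sum>\<^sub>\<infinity>v\<in>V. norm (f v * \<mu> v) powr p) powr (1 / p)"

definition c0_space :: "'v set \<Rightarrow> ('v \<Rightarrow> complex) \<Rightarrow> ('v \<Rightarrow> complex) set" where
  "c0_space V \<mu> =
     {f \<in> funs_on V. \<forall>\<epsilon>>0. \<exists>F. finite F \<and> F \<subseteq> V \<and> (\<forall>v\<in>V - F. norm (f v * \<mu> v) < \<epsilon>)}"

definition c0_norm :: "'v set \<Rightarrow> ('v \<Rightarrow> complex) \<Rightarrow> ('v \<Rightarrow> complex) \<Rightarrow> real" where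
  "c0_norm V \<mu> f = (SUP v\<in>V. norm (f v * \<mu> v))"


section \<open>Operators on a space of functions with a norm\<close>

text \<open>
  A normed space is given by its carrier \<open>X\<close> and its norm \<open>N\<close>. The distance is set to 0 off the
  carrier because the locale \<open>Metric_space\<close> demands nonnegativity and symmetry for all arguments,
  and \<open>N\<close> is arbitrary outside \<open>X\<close>.
\<close>

definition norm_dist ::
  "('v \<Rightarrow> complex) set \<Rightarrow> (('v \<Rightarrow> complex) \<Rightarrow> real) \<Rightarrow> ('v \<Rightarrow> complex) \<Rightarrow> ('v \<Rightarrow> complex) \<Rightarrow> real" where
  "norm_dist X N f g = (if f \<in> X \<and> g \<in> X then N (\<lambda>v. f v - g v) else 0)"

definition norm_topology ::
  "('v \<Rightarrow> complex) set \<Rightarrow> (('v \<Rightarrow> complex) \<Rightarrow> real) \<Rightarrow> ('v \<Rightarrow> complex) topology" where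
  "norm_topology X N = Metric_space.mtopology X (norm_dist X N)"

definition bounded_operator_on ::
  "('v \<Rightarrow> complex) set \<Rightarrow> (('v \<Rightarrow> complex) \<Rightarrow> real) \<Rightarrow> (('v \<Rightarrow> complex) \<Rightarrow> ('v \<Rightarrow> complex)) \<Rightarrow> bool" where
  "bounded_operator_on X N T \<longleftrightarrow>
     (\<forall>f\<in>X. T f \<in> X) \<and>
     (\<forall>f\<in>X. \<forall>g\<in>X. T (\<lambda>v. f v + g v) = (\<lambda>v. T f v + T g v)) \<and>
     (\<forall>c. \<forall>f\<in>X. T (\<lambda>v. c * f v) = (\<lambda>v. c * T f v)) \<and>
     (\<exists>C. \<forall>f\<in>X. N (T f) \<le> C * N f)"

definition hypercyclic :: "'a topology \<Rightarrow> ('a \<Rightarrow> 'a) \<Rightarrow> bool" where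
  "hypercyclic \<tau> T \<longleftrightarrow>
     (\<exists>x\<in>topspace \<tau>. \<tau> closure_of (range (\<lambda>n. (T ^^ n) x)) = topspace \<tau>)"

definition weakly_mixing :: "'a topology \<Rightarrow> ('a \<Rightarrow> 'a) \<Rightarrow> bool" where
  "weakly_mixing \<tau> T \<longleftrightarrow> hypercyclic (prod_topology \<tau> \<tau>) (map_prod T T)"


section \<open>Backward shifts on directed graphs\<close>

definition Chi :: "'v rel \<Rightarrow> 'v \<Rightarrow> 'v set" where
  "Chi E v = {u. (v, u) \<in> E}"

definition backward_shift :: "'v rel \<Rightarrow> ('v \<Rightarrow> complex) \<Rightarrow> ('v \<Rightarrow> complex)" where
  "backward_shift E f = (\<lambda>v. \<Sum>u\<in>Chi E v. f u)"

text \<open>The pair \<open>(i, j)\<close> stands for the vertex \<open>v\<^sub>i\<^sub>,\<^sub>j\<close>.\<close>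

definition grid_verts :: "nat \<Rightarrow> (nat \<times> nat) set" where
  "grid_verts m = {1..m} \<times> {1..}"

definition grid_edges :: "nat \<Rightarrow> (nat \<times> nat) rel" where
  "grid_edges m =
     {((i, j), (i, j + 1)) | i j. 1 \<le> i \<and> i \<le> m \<and> 1 \<le> j} \<union>
     {((i, j), (i + 1, j)) | i j. 1 \<le> i \<and> i + 1 \<le> m \<and> 1 \<le> j}"

end

theory Submission
  imports Defs
begin

text \<open>
  If \<open>x\<close> is a hypercyclic vector and \<open>B\<^sup>n x\<close> is close to a target with entries \<open>(-1)^(m - i)\<close> in row
  \<open>i\<close>, then solving \<open>(B f)(i, q) = f(i, q + 1) + f(i + 1, q)\<close> backwards is, up to signs, Pascal's
  recursion. Hence \<open>x\<close> has an entry of size at least a constant times \<open>n^(m - i)\<close> at distance about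
  \<open>n\<close> in row \<open>i\<close>, and since \<open>x \<in> X\<close> the weight there must be small compared with \<open>n^(-(m - i))\<close>. This
  is (iv). Boundedness of \<open>B\<close> gives \<open>|\<mu>(i, j)| \<le> C |\<mu>(i, j + 1)|\<close>, so moving back by a fixed number
  of columns keeps the weights small, and a diagonal choice gives (iii). Conversely, \<open>B\<close> has a right
  inverse \<open>R\<close> with \<open>(R\<^sup>n y)(i, \<cdot>) = O(n^(m - i))\<close> for finitely supported \<open>y\<close>, and \<open>B\<^sup>n y\<close> vanishes for
  large \<open>n\<close>; under (iii) a series of vectors \<open>R^(n\<^sub>k) y\<^sub>k\<close> with \<open>n\<^sub>k\<close> growing fast enough therefore has
  a dense orbit, and the same \<open>n\<^sub>k\<close> serve for two such series at once.
\<close>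

section \<open>Weighted spaces in which finitely supported functions are dense\<close>

abbreviation unit_at :: "'v \<Rightarrow> 'v \<Rightarrow> complex" where
  "unit_at v \<equiv> (\<lambda>u. if u = v then 1 else 0)"

text \<open>These axioms collect what l^p and c0 have in common, so that one argument serves both.
  Together with \<open>norm_coord\<close>, the bound \<open>norm_unit\<close> is an equality, and
  \<open>finite_approx\<close> says that tails become small in norm.\<close>

locale weighted_space =
  fixes V :: "'v set" and \<mu> :: "'v \<Rightarrow> complex"
    and X :: "('v \<Rightarrow> complex) set" and N :: "('v \<Rightarrow> complex) \<Rightarrow> real"
  assumes weight_nz: "v \<in> V \<Longrightarrow> \<mu> v \<noteq> 0"
    and space_vanish: "\<lbrakk>f \<in> X; v \<notin> V\<rbrakk> \<Longrightarrow> f v = 0"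
    and space_zero: "(\<lambda>v. 0) \<in> X"
    and space_add: "\<lbrakk>f \<in> X; g \<in> X\<rbrakk> \<Longrightarrow> (\<lambda>v. f v + g v) \<in> X"
    and space_scale: "f \<in> X \<Longrightarrow> (\<lambda>v. c * f v) \<in> X"
    and norm_triangle: "\<lbrakk>f \<in> X; g \<in> X\<rbrakk> \<Longrightarrow> N (\<lambda>v. f v + g v) \<le> N f + N g"
    and norm_scale: "f \<in> X \<Longrightarrow> N (\<lambda>v. c * f v) = norm c * N f"
    and norm_coord: "\<lbrakk>f \<in> X; v \<in> V\<rbrakk> \<Longrightarrow> norm (f v * \<mu> v) \<le> N f"
    and space_unit: "v \<in> V \<Longrightarrow> unit_at v \<in> X"
    and norm_unit: "v \<in> V \<Longrightarrow> N (unit_at v) \<le> norm (\<mu> v)"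
    and finite_approx: "\<lbrakk>f \<in> X; \<epsilon> > 0\<rbrakk> \<Longrightarrow>
      \<exists>F. finite F \<and> F \<subseteq> V \<and> N (\<lambda>v. if v \<in> F then 0 else f v) < \<epsilon>"
begin

section \<open>The induced metric and its topology\<close>

lemma norm_zero: "N (\<lambda>v. 0) = 0"
  using norm_scale[OF space_zero, of 0] by simp

lemma space_minus: "f \<in> X \<Longrightarrow> (\<lambda>v. - f v) \<in> X"
  using space_scale[of f "-1"] by simp

lemma norm_minus: "f \<in> X \<Longrightarrow> N (\<lambda>v. - f v) = N f"
  using norm_scale[of f "-1"] by simp

lemma space_diff: "\<lbrakk>f \<in> X; g \<in> X\<rbrakk> \<Longrightarrow> (\<lambda>v. f v - g v) \<in> X"
  using space_add[OF _ space_minus, of f g] by simp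

lemma norm_nonneg: "f \<in> X \<Longrightarrow> 0 \<le> N f"
  using norm_triangle[OF _ space_minus, of f f] norm_minus[of f] norm_zero by simp

lemma norm_diff_triangle:
  assumes "f \<in> X" "g \<in> X" "h \<in> X"
  shows "N (\<lambda>v. f v - h v) \<le> N (\<lambda>v. f v - g v) + N (\<lambda>v. g v - h v)"
  using norm_triangle[OF space_diff[OF assms(1,2)] space_diff[OF assms(2,3)]] by simp

lemma norm_diff_commute:
  assumes "f \<in> X" "g \<in> X"
  shows "N (\<lambda>v. f v - g v) = N (\<lambda>v. g v - f v)"
  using norm_minus[OF space_diff[OF assms]] by simp

lemma norm_eq_0_imp:
  assumes "f \<in> X" "N f = 0"
  shows "f = (\<lambda>v. 0)"
proof
  fix v
  show "f v = 0"
    using norm_coord[OF assms(1), of v] assms weight_nz[of v] space_vanish[OF assms(1), of v]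
    by (cases "v \<in> V") auto
qed

lemma metric: "Metric_space X (norm_dist X N)"
proof
  fix f g h :: "'v \<Rightarrow> complex"
  show "0 \<le> norm_dist X N f g"
    by (simp add: norm_dist_def norm_nonneg space_diff)
  show "norm_dist X N f g = norm_dist X N g f"
    by (auto simp: norm_dist_def intro: norm_diff_commute)
  assume fg: "f \<in> X" "g \<in> X"
  show "(norm_dist X N f g = 0) = (f = g)"
  proof
    assume "norm_dist X N f g = 0"
    then have "(\<lambda>v. f v - g v) = (\<lambda>v. 0)"
      using fg by (intro norm_eq_0_imp space_diff) (auto simp: norm_dist_def)
    then show "f = g" by (metis eq_iff_diff_eq_0 ext)
  qed (use fg norm_zero in \<open>simp add: norm_dist_def\<close>)
  assume "h \<in> X"
  then show "norm_dist X N f h \<le> norm_dist X N f g + norm_dist X N g h"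
    using fg by (simp add: norm_dist_def norm_diff_triangle)
qed

sublocale Metric_space X "norm_dist X N"
  by (rule metric)

lemma topspace_norm_topology [simp]: "topspace (norm_topology X N) = X"
  by (simp add: norm_topology_def)

lemma openin_norm_topology_ball:
  assumes "openin (norm_topology X N) U" "f \<in> U"
  obtains r where "r > 0" "\<And>g. \<lbrakk>g \<in> X; N (\<lambda>v. g v - f v) < r\<rbrakk> \<Longrightarrow> g \<in> U"
proof -
  have U: "U \<subseteq> X" and "\<exists>r>0. mball f r \<subseteq> U"
    using assms unfolding norm_topology_def openin_mtopology by auto
  then obtain r where r: "r > 0" "mball f r \<subseteq> U" by auto
  show thesis
  proof (rule that[OF r(1)])
    fix g assume "g \<in> X" "N (\<lambda>v. g v - f v) < r"
    then have "g \<in> mball f r"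
      using U assms(2) norm_diff_commute[of f g] by (auto simp: norm_dist_def)
    then show "g \<in> U" using r(2) by auto
  qed
qed

lemma closure_of_normD:
  assumes "f \<in> norm_topology X N closure_of S" "r > 0"
  shows "\<exists>g\<in>S. g \<in> X \<and> N (\<lambda>v. g v - f v) < r"
proof -
  have f: "f \<in> X" using assms(1) in_closure_of[of f] by simp
  have "\<exists>g\<in>S. g \<in> mball f r"
    using assms unfolding norm_topology_def metric_closure_of by auto
  then obtain g where "g \<in> S" "g \<in> mball f r" by auto
  then show ?thesis
    using norm_diff_commute[OF f, of g] by (intro bexI[of _ g]) (auto simp: norm_dist_def)
qed

section \<open>Finitely supported functions and absolutely convergent series\<close>

text \<open>Induction on the support, peeling off one multiple of a unit vector at a time. The crude
  triangle bound turns decay of the weights into decay of the norm uniformly in all the spaces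
  considered.\<close>

lemma finsupp_in_space:
  assumes "finite F" "F \<subseteq> V" "\<And>v. v \<notin> F \<Longrightarrow> f v = 0"
  shows "f \<in> X \<and> N f \<le> (\<Sum>v\<in>F. norm (f v) * norm (\<mu> v))"
  using assms
proof (induction F arbitrary: f rule: finite_induct)
  case empty
  then have "f = (\<lambda>v. 0)" by auto
  then show ?case by (simp add: space_zero norm_zero)
next
  case (insert w F)
  define g where "g = (\<lambda>v. if v = w then 0 else f v)"
  define e where "e = (\<lambda>v. f w * unit_at w v)"
  have w: "w \<in> V" using insert.prems by auto
  have g: "g \<in> X \<and> N g \<le> (\<Sum>v\<in>F. norm (g v) * norm (\<mu> v))"
    using insert.prems by (intro insert.IH) (auto simp: g_def)
  have e: "e \<in> X" "N e \<le> norm (f w) * norm (\<mu> w)"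
    unfolding e_def using norm_scale[OF space_unit[OF w], of "f w"] norm_unit[OF w]
    by (auto simp: space_scale space_unit w mult_left_mono)
  have f: "f = (\<lambda>v. e v + g v)" by (auto simp: e_def g_def)
  have "(\<Sum>v\<in>F. norm (g v) * norm (\<mu> v)) = (\<Sum>v\<in>F. norm (f v) * norm (\<mu> v))"
    using insert.hyps by (intro sum.cong) (auto simp: g_def)
  then show ?case
    using g e norm_triangle[of e g] space_add[of e g] insert.hyps by (auto simp flip: f)
qed

text \<open>Outside the finite set given by \<open>finite_approx\<close>, every weighted coordinate
  is dominated by the norm of the tail.\<close>

lemma finite_coords_ge:
  assumes "f \<in> X" "\<epsilon> > 0"
  shows "finite {v \<in> V. \<epsilon> \<le> norm (f v * \<mu> v)}"
proof -
  obtain F where F: "finite F" "F \<subseteq> V" "N (\<lambda>v. if v \<in> F then 0 else f v) < \<epsilon>"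
    using finite_approx[OF assms] by auto
  define g where "g = (\<lambda>v. if v \<in> F then f v else 0)"
  have "g \<in> X" using finsupp_in_space[OF F(1,2), of g] by (simp add: g_def)
  from space_diff[OF assms(1) this] have "(\<lambda>v. if v \<in> F then 0 else f v) \<in> X"
    by (rule back_subst[of "\<lambda>h. h \<in> X"]) (auto simp: g_def)
  from norm_coord[OF this] F(3) have "{v \<in> V. \<epsilon> \<le> norm (f v * \<mu> v)} \<subseteq> F"
    by (fastforce split: if_splits)
  then show ?thesis using F(1) finite_subset by blast
qed

lemma partial_sums:
  assumes "\<And>k. g k \<in> X" "\<And>k. N (g k) \<le> a k"
  shows "(\<lambda>v. \<Sum>k<K::nat. g k v) \<in> X \<and> N (\<lambda>v. \<Sum>k<K. g k v) \<le> (\<Sum>k<K. a k)"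
proof (induction K)
  case (Suc K)
  then show ?case
    using norm_triangle[of "\<lambda>v. \<Sum>k<K. g k v" "g K"] space_add[of "\<lambda>v. \<Sum>k<K. g k v" "g K"]
      assms(1)[of K] assms(2)[of K] by simp
qed (simp add: space_zero norm_zero)

lemma partial_sums_le_suminf:
  assumes "\<And>k. g k \<in> X" "\<And>k. N (g k) \<le> a k" "summable a"
  shows "N (\<lambda>v. \<Sum>k<K::nat. g k v) \<le> suminf a"
proof -
  have "a k \<ge> 0" for k using norm_nonneg[OF assms(1)[of k]] assms(2)[of k] by linarith
  then have "(\<Sum>k<K. a k) \<le> suminf a" using assms(3) by (intro sum_le_suminf) auto
  then show ?thesis using partial_sums[of g a K, OF assms(1,2)] by linarith
qed

text \<open>On \<open>V\<close>, evaluation at \<open>v\<close> is a functional of norm at most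
  \<open>1 / norm (\<mu> v)\<close>, so the series of coordinates is dominated by a multiple of
  \<open>a\<close>.\<close>

lemma summable_coords:
  assumes "\<And>k. g k \<in> X" "\<And>k. N (g k) \<le> a k" "summable a"
  shows "summable (\<lambda>k. g k v)"
proof (cases "v \<in> V")
  case True
  have "norm (g k v) \<le> a k / norm (\<mu> v)" for k
    using norm_coord[OF assms(1)[of k] True] assms(2)[of k] weight_nz[OF True]
    by (simp add: norm_mult field_simps)
  then show ?thesis
    by (rule summable_comparison_test'[OF summable_divide[OF assms(3)], of 0])
next
  case False
  then show ?thesis using space_vanish[OF assms(1)] by simp
qed

text \<open>A limit of bounds on partial sums. It does not presuppose that the pointwise sum belongs
  to \<open>X\<close>, so it can be used to prove completeness.\<close>

lemma coords_suminf_le: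
  assumes "\<And>k. g k \<in> X" "\<And>k. N (g k) \<le> a k" "summable a" "v \<in> V"
  shows "norm ((\<Sum>k. g k v) * \<mu> v) \<le> suminf a"
proof (rule tendsto_upperbound)
  show "(\<lambda>K. norm ((\<Sum>k<K. g k v) * \<mu> v)) \<longlonglongrightarrow> norm ((\<Sum>k. g k v) * \<mu> v)"
    by (intro tendsto_intros summable_LIMSEQ summable_coords[of g a] assms)
  show "\<forall>\<^sub>F K in sequentially. norm ((\<Sum>k<K. g k v) * \<mu> v) \<le> suminf a"
    using norm_coord[OF _ assms(4), of "\<lambda>v. \<Sum>k<_. g k v"] partial_sums[of g a, OF assms(1,2)]
      partial_sums_le_suminf[of g a, OF assms(1-3)]
    by (intro always_eventually allI) (meson order_trans)
qed simp

end

text \<open>Completeness, in the form of convergence of absolutely convergent series.\<close>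

locale complete_weighted_space = weighted_space +
  assumes series: "\<lbrakk>\<And>k. g k \<in> X; \<And>k. N (g k) \<le> a k; summable a\<rbrakk> \<Longrightarrow>
      (\<lambda>v. \<Sum>k. g k v) \<in> X \<and> N (\<lambda>v. \<Sum>k. g k v) \<le> suminf a"

subsection \<open>The spaces \<open>\<ell>\<^sup>p\<close>\<close>

text \<open>For positive arguments this is convexity of \<open>powr\<close>. If one argument is 0,
  it reduces to \<open>(s * z) powr p \<le> s * z powr p\<close>, which follows from
  \<open>s powr p \<le> s\<close> on the unit interval.\<close>

lemma powr_convex_combination:
  fixes x y t p :: real
  assumes "p \<ge> 1" "x \<ge> 0" "y \<ge> 0" "0 \<le> t" "t \<le> 1"
  shows "(t * x + (1 - t) * y) powr p \<le> t * x powr p + (1 - t) * y powr p"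
proof -
  have shrink: "(s * z) powr p \<le> s * z powr p" if "0 \<le> s" "s \<le> 1" "0 \<le> z" for s z :: real
  proof -
    have "s powr p \<le> s" using that assms(1) powr_mono'[of 1 p s] by (cases "s = 0") auto
    then show ?thesis using that by (simp add: powr_mult mult_right_mono)
  qed
  show ?thesis
  proof (cases "x = 0 \<or> y = 0")
    case True
    then show ?thesis using shrink[of t x] shrink[of "1 - t" y] assms by auto
  next
    case False
    then show ?thesis
      using convex_onD[OF powr_convex[OF assms(1)], of "1 - t" x y] assms
      by (simp add: algebra_simps)
  qed
qed

text \<open>Convexity applied to \<open>x / A\<close> and \<open>y / B\<close> with weights
  \<open>A / (A + B)\<close> and \<open>B / (A + B)\<close>. With \<open>A\<close> and
  \<open>B\<close> bounds for two norms, summation over the coordinates yields Minkowski's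
  inequality.\<close>

lemma powr_add_le_weighted:
  fixes x y A B p :: real
  assumes "p \<ge> 1" "x \<ge> 0" "y \<ge> 0" "A > 0" "B > 0"
  shows "(x + y) powr p \<le>
    (A + B) powr p * (A / (A + B) * (x powr p / A powr p) + B / (A + B) * (y powr p / B powr p))"
proof -
  have B: "1 - A / (A + B) = B / (A + B)" using assms by (simp add: field_simps)
  have "A / (A + B) * (x / A) + B / (A + B) * (y / B) = (x + y) / (A + B)"
    using assms by (simp add: add_divide_distrib)
  then have "(x + y) powr p = ((A + B) * (A / (A + B) * (x / A) + (1 - A / (A + B)) * (y / B))) powr p"
    using assms by (simp add: B)
  also have "\<dots> = (A + B) powr p * (A / (A + B) * (x / A) + (1 - A / (A + B)) * (y / B)) powr p"
    by (rule powr_mult)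
  also have "(A / (A + B) * (x / A) + (1 - A / (A + B)) * (y / B)) powr p
      \<le> A / (A + B) * (x / A) powr p + (1 - A / (A + B)) * (y / B) powr p"
    using assms by (intro powr_convex_combination) auto
  also note B
  finally show ?thesis
    using assms by (simp add: powr_divide)
qed

locale lp_setting =
  fixes p :: real and V :: "'v set" and \<mu> :: "'v \<Rightarrow> complex"
  assumes p: "p \<ge> 1" and weight: "weight_on V \<mu>"
begin

abbreviation "X \<equiv> lp_space p V \<mu>"
abbreviation "N \<equiv> lp_norm p V \<mu>"
abbreviation "t f v \<equiv> norm (f v * \<mu> v) powr p"

lemma norm_le_iff:
  assumes "A \<ge> 0"
  shows "N f \<le> A \<longleftrightarrow> (\<Sum>\<^sub>\<infinity>v\<in>V. t f v) \<le> A powr p"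
proof -
  have S: "(\<Sum>\<^sub>\<infinity>v\<in>V. t f v) \<ge> 0" by (intro infsum_nonneg) auto
  have "N f \<le> A \<longleftrightarrow> N f powr p \<le> A powr p"
    using p assms powr_mono2[of p "N f" A] powr_less_mono2[of p A "N f"]
    by (auto simp: lp_norm_def not_le[symmetric])
  also have "N f powr p = (\<Sum>\<^sub>\<infinity>v\<in>V. t f v)"
    using p S by (simp add: lp_norm_def powr_powr)
  finally show ?thesis .
qed

lemma norm_nonneg: "N f \<ge> 0" by (simp add: lp_norm_def)

text \<open>Finite partial sums certify membership and the norm bound at the same time. With the
  converse \<open>memD\<close>, the l^p estimates below become estimates of finite sums.\<close>

lemma memI:
  assumes "\<And>v. v \<notin> V \<Longrightarrow> f v = 0" "\<And>F. \<lbrakk>finite F; F \<subseteq> V\<rbrakk> \<Longrightarrow> (\<Sum>v\<in>F. t f v) \<le> A powr p" "A \<ge> 0"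
  shows "f \<in> X \<and> N f \<le> A"
proof -
  have *: "t f summable_on V"
    using assms(2) by (intro nonneg_bdd_above_summable_on bdd_aboveI[of _ "A powr p"]) auto
  have "(\<Sum>\<^sub>\<infinity>v\<in>V. t f v) \<le> A powr p"
    using assms(2) by (intro infsum_le_finite_sums[OF *]) auto
  then show ?thesis using * assms by (auto simp: lp_space_def funs_on_def norm_le_iff)
qed

lemma memD:
  assumes "f \<in> X" "finite F" "F \<subseteq> V" "N f \<le> A"
  shows "(\<Sum>v\<in>F. t f v) \<le> A powr p"
proof -
  have "(\<Sum>v\<in>F. t f v) \<le> (\<Sum>\<^sub>\<infinity>v\<in>V. t f v)"
    using assms by (intro finite_sum_le_infsum) (auto simp: lp_space_def)
  also have "\<dots> \<le> A powr p" using assms norm_nonneg[of f] norm_le_iff[of A f] by linarith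
  finally show ?thesis .
qed

text \<open>Minkowski's inequality, stated with positive bounds instead of the norms because the
  proof divides by \<open>A\<close> and \<open>B\<close>.\<close>

lemma add_strict:
  assumes f: "f \<in> X" "N f \<le> A" "A > 0" and g: "g \<in> X" "N g \<le> B" "B > 0"
  shows "(\<lambda>v. f v + g v) \<in> X \<and> N (\<lambda>v. f v + g v) \<le> A + B"
proof (rule memI)
  fix F assume F: "finite F" "F \<subseteq> V"
  have "(\<Sum>v\<in>F. t (\<lambda>v. f v + g v) v) \<le> (\<Sum>v\<in>F.
      (A + B) powr p * (A / (A + B) * (t f v / A powr p) + B / (A + B) * (t g v / B powr p)))"
  proof (rule sum_mono)
    fix v
    have "t (\<lambda>v. f v + g v) v \<le> (norm (f v * \<mu> v) + norm (g v * \<mu> v)) powr p"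
      using p by (intro powr_mono2) (auto simp: distrib_right norm_triangle_ineq)
    also note powr_add_le_weighted[OF p norm_ge_zero norm_ge_zero f(3) g(3)]
    finally show "t (\<lambda>v. f v + g v) v \<le>
      (A + B) powr p * (A / (A + B) * (t f v / A powr p) + B / (A + B) * (t g v / B powr p))" .
  qed
  also have "\<dots> = (A + B) powr p * (A / (A + B) * ((\<Sum>v\<in>F. t f v) / A powr p)
      + B / (A + B) * ((\<Sum>v\<in>F. t g v) / B powr p))"
    by (simp only: sum_distrib_left[symmetric] sum.distrib sum_divide_distrib[symmetric])
  \<comment> \<open>By \<open>memD\<close> both normalised sums are at most 1.\<close>
  also have "\<dots> \<le> (A + B) powr p * (A / (A + B) * 1 + B / (A + B) * 1)"
    using memD[OF f(1) F f(2)] memD[OF g(1) F g(2)] f(3) g(3)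
    by (intro mult_left_mono add_mono) auto
  also have "A / (A + B) * 1 + B / (A + B) * 1 = 1" using f(3) g(3) by (simp flip: add_divide_distrib)
  finally show "(\<Sum>v\<in>F. t (\<lambda>v. f v + g v) v) \<le> (A + B) powr p" by simp
qed (use f g in \<open>auto simp: lp_space_def funs_on_def\<close>)

lemma weighted_space: "weighted_space V \<mu> X N"
proof
  show "\<mu> v \<noteq> 0" if "v \<in> V" for v using weight that by (auto simp: weight_on_def)
  show "f v = 0" if "f \<in> X" "v \<notin> V" for f v using that by (auto simp: lp_space_def funs_on_def)
  show "(\<lambda>v. 0) \<in> X" using p by (auto simp: lp_space_def funs_on_def)
  fix f assume f: "f \<in> X"
  show "(\<lambda>v. f v + g v) \<in> X" if "g \<in> X" for g
    using add_strict[OF f _ _ that, of "N f + 1" "N g + 1"] norm_nonneg[of f] norm_nonneg[of g] by auto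
  \<comment> \<open>A norm may be 0, whereas \<open>add_strict\<close> wants positive bounds; an
    arbitrarily small slack bridges the gap.\<close>
  show "N (\<lambda>v. f v + g v) \<le> N f + N g" if "g \<in> X" for g
  proof (rule field_le_epsilon)
    fix e :: real assume "e > 0"
    then show "N (\<lambda>v. f v + g v) \<le> N f + N g + e"
      using add_strict[OF f _ _ that, of "N f + e / 2" "N g + e / 2"] norm_nonneg[of f] norm_nonneg[of g]
      by auto
  qed
  have tc: "t (\<lambda>v. c * f v) = (\<lambda>v. norm c powr p * t f v)" for c
    by (simp add: norm_mult powr_mult mult.assoc)
  show "(\<lambda>v. c * f v) \<in> X" for c
    using f unfolding lp_space_def mem_Collect_eq tc
    by (auto simp: funs_on_def intro: summable_on_cmult_right)
  show "N (\<lambda>v. c * f v) = norm c * N f" for c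
    using p unfolding lp_norm_def tc
    by (simp add: infsum_cmult_right' powr_mult infsum_nonneg powr_powr)
  show "norm (f v * \<mu> v) \<le> N f" if v: "v \<in> V" for v
  proof -
    have "t f v \<le> N f powr p" using memD[OF f, of "{v}" "N f"] v by auto
    then show ?thesis
      using p norm_nonneg[of f] powr_less_mono2[of p "N f" "norm (f v * \<mu> v)"] by force
  qed
  fix \<epsilon> :: real assume "\<epsilon> > 0"
  then have e: "0 < (\<epsilon> / 2) powr p" by simp
  have sf: "t f summable_on V" using f by (auto simp: lp_space_def)
  obtain F where F: "finite F" "F \<subseteq> V" "dist (sum (t f) F) (infsum (t f) V) \<le> (\<epsilon> / 2) powr p"
    using infsum_finite_approximation[OF sf e] by auto
  \<comment> \<open>A finite sum of the truncated function only sees vertices outside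
    \<open>F\<close>, so it is at most the total sum minus the sum over \<open>F\<close>. The factor
    1/2 makes the final inequality strict.\<close>
  have "N (\<lambda>v. if v \<in> F then 0 else f v) \<le> \<epsilon> / 2"
  proof (rule memI[THEN conjunct2])
    fix G assume G: "finite G" "G \<subseteq> V"
    have "sum (t (\<lambda>v. if v \<in> F then 0 else f v)) G = sum (t f) (G - F)"
      using G p by (intro sum.mono_neutral_cong_right) auto
    also have "\<dots> = sum (t f) (F \<union> (G - F)) - sum (t f) F"
      using F G by (subst sum.union_disjoint) auto
    also have "\<dots> \<le> infsum (t f) V - sum (t f) F"
      using F G by (intro diff_right_mono finite_sum_le_infsum[OF sf]) auto
    also have "\<dots> \<le> (\<epsilon> / 2) powr p" using F(3) by (auto simp: dist_real_def)
    finally show "sum (t (\<lambda>v. if v \<in> F then 0 else f v)) G \<le> (\<epsilon> / 2) powr p" .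
  qed (use f \<open>\<epsilon> > 0\<close> in \<open>auto simp: lp_space_def funs_on_def\<close>)
  then show "\<exists>F. finite F \<and> F \<subseteq> V \<and> N (\<lambda>v. if v \<in> F then 0 else f v) < \<epsilon>"
    using F \<open>\<epsilon> > 0\<close> by (intro exI[of _ F]) auto
next
  fix v assume v: "v \<in> V"
  have "unit_at v \<in> X \<and> N (unit_at v) \<le> norm (\<mu> v)"
  proof (rule memI)
    fix F assume F: "finite F" "F \<subseteq> V"
    have "sum (t (unit_at v)) F \<le> (\<Sum>u\<in>F. if v = u then t (unit_at v) v else 0)"
      by (intro sum_mono) (use p in auto)
    also have "\<dots> \<le> norm (\<mu> v) powr p" using F by simp
    finally show "sum (t (unit_at v)) F \<le> norm (\<mu> v) powr p" .
  qed (use v in auto)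
  then show "unit_at v \<in> X" "N (unit_at v) \<le> norm (\<mu> v)" by auto
qed

text \<open>An argument of Fatou type: on each finite set of vertices the bound for the partial sums
  of the series survives the coordinatewise limit, and \<open>memI\<close> asks for nothing
  more.\<close>

lemma complete_weighted_space: "complete_weighted_space V \<mu> X N"
proof -
  interpret weighted_space V \<mu> X N by (rule weighted_space)
  show ?thesis
  proof
    fix g a assume g: "\<And>k. g k \<in> X" "\<And>k. N (g k) \<le> a k" "summable a"
    have a: "suminf a \<ge> 0" using partial_sums_le_suminf[of g a 0, OF g] norm_zero by simp
    show "(\<lambda>v. \<Sum>k. g k v) \<in> X \<and> N (\<lambda>v. \<Sum>k. g k v) \<le> suminf a"
    proof (rule memI)
      fix F assume F: "finite F" "F \<subseteq> V"
      show "sum (t (\<lambda>v. \<Sum>k. g k v)) F \<le> suminf a powr p"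
      proof (rule tendsto_upperbound)
        show "(\<lambda>K. sum (t (\<lambda>v. \<Sum>k<K. g k v)) F) \<longlonglongrightarrow> sum (t (\<lambda>v. \<Sum>k. g k v)) F"
          using p by (intro tendsto_intros summable_LIMSEQ summable_coords[of g a] g) auto
        show "\<forall>\<^sub>F K in sequentially. sum (t (\<lambda>v. \<Sum>k<K. g k v)) F \<le> suminf a powr p"
          using F partial_sums[of g a, OF g(1,2)] partial_sums_le_suminf[of g a, OF g]
          by (intro always_eventually allI memD) auto
      qed simp
    qed (use a space_vanish[OF g(1)] in auto)
  qed
qed

end

subsection \<open>The space \<open>c\<^sub>0\<close>\<close>

locale c0_setting =
  fixes V :: "'v set" and \<mu> :: "'v \<Rightarrow> complex"
  assumes nonempty: "V \<noteq> {}" and weight: "weight_on V \<mu>"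
begin

abbreviation "X \<equiv> c0_space V \<mu>"
abbreviation "N \<equiv> c0_norm V \<mu>"

lemma memD:
  assumes "f \<in> X" "e > 0"
  obtains F where "finite F" "F \<subseteq> V" "\<And>v. v \<in> V - F \<Longrightarrow> norm (f v * \<mu> v) < e"
  using assms by (auto simp: c0_space_def)

lemma bdd:
  assumes "f \<in> X"
  shows "bdd_above ((\<lambda>v. norm (f v * \<mu> v)) ` V)"
proof -
  obtain F where F: "finite F" "F \<subseteq> V" "\<And>v. v \<in> V - F \<Longrightarrow> norm (f v * \<mu> v) < 1"
    using memD[OF assms zero_less_one] by blast
  have "norm (f v * \<mu> v) \<le> 1 + (\<Sum>v\<in>F. norm (f v * \<mu> v))" if "v \<in> V" for v
    using F(3)[of v] that member_le_sum[of v F "\<lambda>v. norm (f v * \<mu> v)"] F(1)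
      sum_nonneg[of F "\<lambda>v. norm (f v * \<mu> v)"]
    by (cases "v \<in> F") auto
  then show ?thesis by (auto intro!: bdd_aboveI)
qed

lemma norm_coord: "\<lbrakk>f \<in> X; v \<in> V\<rbrakk> \<Longrightarrow> norm (f v * \<mu> v) \<le> N f"
  unfolding c0_norm_def by (rule cSUP_upper[OF _ bdd])

lemma norm_leI: "(\<And>v. v \<in> V \<Longrightarrow> norm (f v * \<mu> v) \<le> A) \<Longrightarrow> N f \<le> A"
  unfolding c0_norm_def by (rule cSUP_least[OF nonempty])

lemma memI:
  assumes "\<And>v. v \<notin> V \<Longrightarrow> f v = 0"
    and "\<And>e. e > 0 \<Longrightarrow> \<exists>F. finite F \<and> F \<subseteq> V \<and> (\<forall>v\<in>V - F. norm (f v * \<mu> v) < e)"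
  shows "f \<in> X"
  using assms by (auto simp: c0_space_def funs_on_def)

lemma vanish: "\<lbrakk>f \<in> X; v \<notin> V\<rbrakk> \<Longrightarrow> f v = 0"
  by (auto simp: c0_space_def funs_on_def)

lemma add: 
  assumes "f \<in> X" "g \<in> X" shows "(\<lambda>v. f v + g v) \<in> X"
proof (rule memI)
  fix e :: real assume "e > 0"
  then have "e / 2 > 0" by simp
  obtain F where F: "finite F" "F \<subseteq> V" "\<And>v. v \<in> V - F \<Longrightarrow> norm (f v * \<mu> v) < e / 2"
    using memD[OF assms(1) \<open>e / 2 > 0\<close>] by blast
  obtain G where G: "finite G" "G \<subseteq> V" "\<And>v. v \<in> V - G \<Longrightarrow> norm (g v * \<mu> v) < e / 2"
    using memD[OF assms(2) \<open>e / 2 > 0\<close>] by blast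
  have "norm ((f v + g v) * \<mu> v) < e" if "v \<in> V - (F \<union> G)" for v
    using F(3)[of v] G(3)[of v] that norm_triangle_ineq[of "f v * \<mu> v" "g v * \<mu> v"]
    by (auto simp: distrib_right)
  then show "\<exists>F. finite F \<and> F \<subseteq> V \<and> (\<forall>v\<in>V - F. norm ((f v + g v) * \<mu> v) < e)"
    using F G by (intro exI[of _ "F \<union> G"]) auto
qed (simp add: vanish[OF assms(1)] vanish[OF assms(2)])

lemma scale:
  assumes "f \<in> X" shows "(\<lambda>v. c * f v) \<in> X"
proof (rule memI)
  fix e :: real assume e: "e > 0"
  then have e': "e / (norm c + 1) > 0" by (simp add: add_nonneg_pos)
  obtain F where F: "finite F" "F \<subseteq> V" "\<And>v. v \<in> V - F \<Longrightarrow> norm (f v * \<mu> v) < e / (norm c + 1)"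
    using memD[OF assms e'] by blast
  have "norm (c * f v * \<mu> v) < e" if "v \<in> V - F" for v
  proof -
    have "norm (c * f v * \<mu> v) \<le> (norm c + 1) * norm (f v * \<mu> v)"
      by (simp add: norm_mult mult.assoc mult_right_mono)
    also have "\<dots> < e"
      using F(3)[OF that] by (simp add: pos_less_divide_eq add_nonneg_pos mult.commute)
    finally show ?thesis .
  qed
  then show "\<exists>F. finite F \<and> F \<subseteq> V \<and> (\<forall>v\<in>V - F. norm (c * f v * \<mu> v) < e)"
    using F by auto
qed (simp add: vanish[OF assms])

lemma norm_scale_le:
  assumes "f \<in> X" shows "N (\<lambda>v. c * f v) \<le> norm c * N f"
  by (rule norm_leI) (simp add: norm_coord[OF assms, simplified norm_mult] norm_mult mult.assoc mult_left_mono)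

lemma weighted_space: "weighted_space V \<mu> X N"
proof
  show "\<mu> v \<noteq> 0" if "v \<in> V" for v using weight that by (auto simp: weight_on_def)
  show "(\<lambda>v. 0) \<in> X" by (rule memI) auto
  fix f assume f: "f \<in> X"
  show "N (\<lambda>v. f v + g v) \<le> N f + N g" if "g \<in> X" for g
  proof (rule norm_leI)
    fix v assume "v \<in> V"
    then show "norm ((f v + g v) * \<mu> v) \<le> N f + N g"
      using norm_coord[OF f] norm_coord[OF that] norm_triangle_ineq[of "f v * \<mu> v" "g v * \<mu> v"]
      by (fastforce simp: distrib_right)
  qed
  show "N (\<lambda>v. c * f v) = norm c * N f" for c
  proof (cases "c = 0")
    case True
    then show ?thesis using nonempty by (simp add: c0_norm_def)
  next
    case False
    \<comment> \<open>Undoing the scaling by \<open>inverse c\<close> gives the inequality opposite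
      to \<open>norm_scale_le\<close>.\<close>
    have "N f \<le> norm (inverse c) * N (\<lambda>v. c * f v)"
      using norm_scale_le[OF scale[OF f, of c], of "inverse c"] False by (simp flip: mult.assoc)
    then show ?thesis
      using norm_scale_le[OF f, of c] False by (simp add: norm_divide field_simps)
  qed
  fix \<epsilon> :: real assume "\<epsilon> > 0"
  then obtain F where F: "finite F" "F \<subseteq> V" "\<And>v. v \<in> V - F \<Longrightarrow> norm (f v * \<mu> v) < \<epsilon> / 2"
    using memD[OF f, of "\<epsilon> / 2"] by auto
  have "N (\<lambda>v. if v \<in> F then 0 else f v) \<le> \<epsilon> / 2"
    using F(3) \<open>\<epsilon> > 0\<close> by (intro norm_leI) (auto intro: less_imp_le)
  then show "\<exists>F. finite F \<and> F \<subseteq> V \<and> N (\<lambda>v. if v \<in> F then 0 else f v) < \<epsilon>"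
    using F \<open>\<epsilon> > 0\<close> by (intro exI[of _ F]) auto
next
  fix v assume v: "v \<in> V"
  show "unit_at v \<in> X"
    using v by (intro memI exI[of _ "{v}"]) auto
  show "N (unit_at v) \<le> norm (\<mu> v)" by (rule norm_leI) auto
qed (use norm_coord add scale vanish in auto)

text \<open>Split the series at \<open>K\<close>: the remainder is uniformly small in all weighted
  coordinates, and the initial segment is a finite sum in c0, hence small off a finite set.\<close>

lemma complete_weighted_space: "complete_weighted_space V \<mu> X N"
proof -
  interpret weighted_space V \<mu> X N by (rule weighted_space)
  show ?thesis
  proof
    fix g a assume g: "\<And>k. g k \<in> X" "\<And>k. N (g k) \<le> a k" "summable a"
    have "(\<lambda>v. \<Sum>k. g k v) \<in> X"
    proof (rule memI)
      fix e :: real assume e: "e > 0"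
      have "(\<lambda>K. \<Sum>k. a (k + K)) \<longlonglongrightarrow> 0" by (rule suminf_exist_split2[OF g(3)])
      then obtain K where K: "(\<Sum>k. a (k + K)) < e / 2"
        using order_tendstoD(2)[of _ 0 sequentially "e / 2"] e by (auto simp: eventually_sequentially)
      obtain F where F: "finite F" "F \<subseteq> V"
          "\<And>v. v \<in> V - F \<Longrightarrow> norm ((\<Sum>k<K. g k v) * \<mu> v) < e / 2"
        using memD[of "\<lambda>v. \<Sum>k<K. g k v" "e / 2"] partial_sums[of g a, OF g(1,2)] e by auto
      have "norm ((\<Sum>k. g k v) * \<mu> v) < e" if v: "v \<in> V - F" for v
      proof -
        have "(\<Sum>k. g k v) * \<mu> v = (\<Sum>k. g (k + K) v) * \<mu> v + (\<Sum>k<K. g k v) * \<mu> v"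
          using suminf_split_initial_segment[OF summable_coords[of g a, OF g], of v K]
          by (simp add: algebra_simps)
        also have "norm \<dots> \<le> (\<Sum>k. a (k + K)) + norm ((\<Sum>k<K. g k v) * \<mu> v)"
          using v g by (intro norm_triangle_le add_right_mono coords_suminf_le)
            (auto simp: summable_iff_shift)
        finally show ?thesis using K F(3)[OF v] by linarith
      qed
      then show "\<exists>F. finite F \<and> F \<subseteq> V \<and> (\<forall>v\<in>V - F. norm ((\<Sum>k. g k v) * \<mu> v) < e)"
        using F by auto
    qed (use vanish[OF g(1)] in auto)
    moreover have "N (\<lambda>v. \<Sum>k. g k v) \<le> suminf a"
      by (intro norm_leI coords_suminf_le g)
    ultimately show "(\<lambda>v. \<Sum>k. g k v) \<in> X \<and> N (\<lambda>v. \<Sum>k. g k v) \<le> suminf a" ..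
  qed
qed

end

section \<open>A dense sequence of finitely supported functions\<close>

text \<open>Finite lists of pairs of a vertex and a coefficient from a countable dense set of
  complex numbers form a countable set. Each list is read as a linear combination of unit vectors,
  and these combinations are dense.\<close>

lemma (in weighted_space) dense_sequence:
  assumes "countable V"
  shows "\<exists>y :: nat \<Rightarrow> 'v \<Rightarrow> complex.
    (\<forall>k. finite {v. y k v \<noteq> 0} \<and> {v. y k v \<noteq> 0} \<subseteq> V) \<and>
    (\<forall>f\<in>X. \<forall>r>0. \<exists>k. N (\<lambda>v. y k v - f v) < r)"
proof -
  obtain D :: "complex set" where D: "countable D" "\<And>U. open U \<Longrightarrow> U \<noteq> {} \<Longrightarrow> \<exists>d\<in>D. d \<in> U"
    using countable_dense_setE by blast
  define dec :: "('v \<times> complex) list \<Rightarrow> 'v \<Rightarrow> complex"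
    where "dec = (\<lambda>l v. \<Sum>(w, c)\<leftarrow>l. c * unit_at w v)"
  have dec_Cons: "dec ((w, c) # l) = (\<lambda>v. c * unit_at w v + dec l v)" for w c l
    by (simp add: dec_def)
  have supp: "finite {v. dec l v \<noteq> 0} \<and> {v. dec l v \<noteq> 0} \<subseteq> V" if "l \<in> lists (V \<times> D)" for l
    using that
  proof (induction l)
    case (Cons wc l)
    obtain w c where wc: "wc = (w, c)" by force
    have "{v. dec (wc # l) v \<noteq> 0} \<subseteq> insert w {v. dec l v \<noteq> 0}"
      by (auto simp: wc dec_Cons)
    then show ?case using Cons wc by (auto dest: finite_subset)
  qed (simp add: dec_def)
  have dec_in_space: "dec l \<in> X" if "l \<in> lists (V \<times> D)" for l
    using finsupp_in_space[OF conjunct1[OF supp[OF that]] conjunct2[OF supp[OF that]], of "dec l"]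
    by simp
  have fin_approx: "\<exists>l\<in>lists (V \<times> D). N (\<lambda>v. dec l v - f v) < r"
    if "finite F" "F \<subseteq> V" "\<And>v. v \<notin> F \<Longrightarrow> f v = 0" "r > 0" for F f r
    using that
  proof (induction F arbitrary: f r rule: finite_induct)
    case empty
    then have "(\<lambda>v. dec [] v - f v) = (\<lambda>v. 0)" by (auto simp: dec_def)
    then show ?case using empty norm_zero by (intro bexI[of _ "[]"]) auto
  next
    case (insert w F)
    define g where "g = (\<lambda>v. if v = w then 0 else f v)"
    have w: "w \<in> V" using insert.prems by auto
    have gF: "g v = 0" if "v \<notin> F" for v using insert.prems(2)[of v] that by (auto simp: g_def)
    obtain l where l: "l \<in> lists (V \<times> D)" "N (\<lambda>v. dec l v - g v) < r / 2"
      using insert.IH[of g "r / 2"] insert.prems gF by auto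
    \<comment> \<open>With this tolerance the error of the coefficient at \<open>w\<close>
      contributes less than \<open>r / 2\<close> to the norm; the list \<open>l\<close> accounts for
      the other half.\<close>
    define s where "s = r / 2 / (norm (\<mu> w) + 1)"
    have s: "s > 0" using insert.prems by (simp add: s_def add_nonneg_pos)
    obtain c where c: "c \<in> D" "norm (c - f w) < s"
      using D(2)[of "ball (f w) s"] s by (auto simp: dist_norm norm_minus_commute)
    have g: "g \<in> X"
      using finsupp_in_space[OF insert.hyps(1), of g] insert.prems by (auto simp: g_def)
    have dl: "dec l \<in> X" by (rule dec_in_space[OF l(1)])
    have eq: "(\<lambda>v. dec ((w, c) # l) v - f v) =
        (\<lambda>v. (c - f w) * unit_at w v + (dec l v - g v))"
      by (auto simp: dec_Cons g_def)
    have "N (\<lambda>v. (c - f w) * unit_at w v) \<le> norm (c - f w) * norm (\<mu> w)"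
      by (simp add: norm_scale space_unit w norm_unit mult_left_mono)
    also have "\<dots> \<le> norm (c - f w) * (norm (\<mu> w) + 1)" by (simp add: mult_left_mono)
    also have "\<dots> < r / 2"
      using c(2) unfolding s_def by (subst (asm) pos_less_divide_eq) (auto simp: add_nonneg_pos)
    finally have "N (\<lambda>v. dec ((w, c) # l) v - f v) < r / 2 + r / 2"
      using norm_triangle[OF space_scale[OF space_unit[OF w], of "c - f w"] space_diff[OF dl g]] l(2)
      unfolding eq by linarith
    then show ?case using l w c by (intro bexI[of _ "(w, c) # l"]) auto
  qed
  have "countable (lists (V \<times> D))" using assms D(1) by (intro countable_lists countable_SIGMA)
  moreover have "lists (V \<times> D) \<noteq> {}" by auto
  ultimately obtain e :: "nat \<Rightarrow> ('v \<times> complex) list" where e: "range e = lists (V \<times> D)"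
    by (intro that[of "from_nat_into (lists (V \<times> D))"] range_from_nat_into)
  have "\<exists>k. N (\<lambda>v. dec (e k) v - f v) < r" if f: "f \<in> X" and r: "r > 0" for f r
  proof -
    obtain F where F: "finite F" "F \<subseteq> V" "N (\<lambda>v. if v \<in> F then 0 else f v) < r / 2"
      using finite_approx[OF f, of "r / 2"] r by auto
    define g where "g = (\<lambda>v. if v \<in> F then f v else 0)"
    have g: "g \<in> X" using finsupp_in_space[OF F(1,2), of g] by (simp add: g_def)
    obtain l where l: "l \<in> lists (V \<times> D)" "N (\<lambda>v. dec l v - g v) < r / 2"
      using fin_approx[OF F(1,2), of g "r / 2"] r by (auto simp: g_def)
    have dl: "dec l \<in> X" by (rule dec_in_space[OF l(1)])
    have "(\<lambda>v. f v - g v) = (\<lambda>v. if v \<in> F then 0 else f v)" by (auto simp: g_def)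
    then have "N (\<lambda>v. dec l v - f v) < r"
      using norm_diff_triangle[OF dl g f] norm_diff_commute[OF f g] l(2) F(3) by simp
    moreover obtain k where "l = e k" using l(1) unfolding e[symmetric] by (elim rangeE)
    ultimately show ?thesis by auto
  qed
  moreover have "e k \<in> lists (V \<times> D)" for k unfolding e[symmetric] by (rule rangeI)
  ultimately show ?thesis using supp by (intro exI[of _ "\<lambda>k. dec (e k)"]) simp
qed

section \<open>Hypercyclicity and weak mixing in terms of the norm\<close>

text \<open>Open rectangles form a base of the product topology, so density of the orbit of a pair
  means that one exponent \<open>n\<close> serves both coordinates.\<close>

lemma (in weighted_space) weakly_mixingI:
  assumes "x \<in> X" "x' \<in> X"
    and "\<And>f f' r. \<lbrakk>f \<in> X; f' \<in> X; r > 0\<rbrakk> \<Longrightarrow>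
      \<exists>n. (T ^^ n) x \<in> X \<and> (T ^^ n) x' \<in> X \<and>
        N (\<lambda>v. (T ^^ n) x v - f v) < r \<and> N (\<lambda>v. (T ^^ n) x' v - f' v) < r"
  shows "weakly_mixing (norm_topology X N) T"
proof -
  let ?\<tau> = "norm_topology X N"
  have pow: "(map_prod T T ^^ n) (x, x') = ((T ^^ n) x, (T ^^ n) x')" for n
    by (induction n) auto
  have "(f, f') \<in> prod_topology ?\<tau> ?\<tau> closure_of (range (\<lambda>n. (map_prod T T ^^ n) (x, x')))"
    if f: "f \<in> X" "f' \<in> X" for f f'
    unfolding in_closure_of
  proof (intro conjI allI impI)
    fix W assume W: "(f, f') \<in> W \<and> openin (prod_topology ?\<tau> ?\<tau>) W"
    then obtain U U' where U: "openin ?\<tau> U" "openin ?\<tau> U'" "f \<in> U" "f' \<in> U'" "U \<times> U' \<subseteq> W"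
      unfolding openin_prod_topology_alt by blast
    obtain r where r: "r > 0" "\<And>g. \<lbrakk>g \<in> X; N (\<lambda>v. g v - f v) < r\<rbrakk> \<Longrightarrow> g \<in> U"
      using openin_norm_topology_ball[OF U(1,3)] by blast
    obtain r' where r': "r' > 0" "\<And>g. \<lbrakk>g \<in> X; N (\<lambda>v. g v - f' v) < r'\<rbrakk> \<Longrightarrow> g \<in> U'"
      using openin_norm_topology_ball[OF U(2,4)] by blast
    obtain n where "(T ^^ n) x \<in> X" "(T ^^ n) x' \<in> X"
        "N (\<lambda>v. (T ^^ n) x v - f v) < min r r'" "N (\<lambda>v. (T ^^ n) x' v - f' v) < min r r'"
      using assms(3)[OF f, of "min r r'"] r(1) r'(1) by auto
    then have "((T ^^ n) x, (T ^^ n) x') \<in> W" using r(2) r'(2) U(5) by auto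
    then show "\<exists>z. z \<in> range (\<lambda>n. (map_prod T T ^^ n) (x, x')) \<and> z \<in> W"
      unfolding pow by blast
  qed (use f in simp)
  then have "prod_topology ?\<tau> ?\<tau> closure_of (range (\<lambda>n. (map_prod T T ^^ n) (x, x'))) = X \<times> X"
    by (intro subset_antisym subrelI) (use closure_of_subset_topspace[of "prod_topology ?\<tau> ?\<tau>"] in auto)
  then show ?thesis
    unfolding weakly_mixing_def hypercyclic_def using assms(1,2) by (intro bexI[of _ "(x, x')"]) auto
qed

text \<open>The first component of a hypercyclic pair is hypercyclic: test the orbit of the pair on
  the open sets \<open>U \<times> topspace \<tau>\<close>.\<close>

lemma weakly_mixing_imp_hypercyclic:
  assumes "weakly_mixing \<tau> T"
  shows "hypercyclic \<tau> T"
proof -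
  obtain z where z: "z \<in> topspace (prod_topology \<tau> \<tau>)"
    "prod_topology \<tau> \<tau> closure_of (range (\<lambda>n. (map_prod T T ^^ n) z)) = topspace (prod_topology \<tau> \<tau>)"
    using assms unfolding weakly_mixing_def hypercyclic_def by (elim bexE)
  then obtain x x' where x: "x \<in> topspace \<tau>"
    and cl: "prod_topology \<tau> \<tau> closure_of (range (\<lambda>n. (map_prod T T ^^ n) (x, x')))
      = topspace \<tau> \<times> topspace \<tau>"
    unfolding topspace_prod_topology by (elim SigmaE) blast
  have pow: "(map_prod T T ^^ n) (x, x') = ((T ^^ n) x, (T ^^ n) x')" for n
    by (induction n) auto
  have "f \<in> \<tau> closure_of (range (\<lambda>n. (T ^^ n) x))" if f: "f \<in> topspace \<tau>" for f
    unfolding in_closure_of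
  proof (intro conjI allI impI)
    fix U assume U: "f \<in> U \<and> openin \<tau> U"
    define S where "S = range (\<lambda>n. (map_prod T T ^^ n) (x, x'))"
    have "(f, f) \<in> prod_topology \<tau> \<tau> closure_of S"
      using f by (simp add: cl S_def)
    then have *: "\<forall>W. (f, f) \<in> W \<and> openin (prod_topology \<tau> \<tau>) W \<longrightarrow> (\<exists>z. z \<in> S \<and> z \<in> W)"
      unfolding in_closure_of by (rule conjunct2)
    have "openin (prod_topology \<tau> \<tau>) (U \<times> topspace \<tau>)"
      using U by (simp add: openin_prod_Times_iff)
    moreover have "(f, f) \<in> U \<times> topspace \<tau>"
      using U f by simp
    ultimately obtain z where z: "z \<in> S" "z \<in> U \<times> topspace \<tau>"
      using * by (elim allE[of _ "U \<times> topspace \<tau>"]) blast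
    from z(1) obtain n where "z = (map_prod T T ^^ n) (x, x')"
      unfolding S_def by (elim rangeE)
    with z(2) have "(T ^^ n) x \<in> U" by (simp add: pow)
    then show "\<exists>z. z \<in> range (\<lambda>n. (T ^^ n) x) \<and> z \<in> U" by blast
  qed (use f in simp)
  then show ?thesis
    unfolding hypercyclic_def using x closure_of_subset_topspace[of \<tau>] by (intro bexI[of _ x]) blast+
qed

lemma (in weighted_space) hypercyclicD:
  assumes "hypercyclic (norm_topology X N) T"
  obtains x where "x \<in> X" "\<And>f r. \<lbrakk>f \<in> X; r > 0\<rbrakk> \<Longrightarrow> \<exists>n. N (\<lambda>v. (T ^^ n) x v - f v) < r"
proof -
  obtain x where x: "x \<in> X" "norm_topology X N closure_of (range (\<lambda>n. (T ^^ n) x)) = X"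
    using assms unfolding hypercyclic_def topspace_norm_topology by (elim bexE)
  show thesis
  proof (rule that[OF x(1)])
    fix f and r :: real assume "f \<in> X" "r > 0"
    then obtain g where g: "g \<in> range (\<lambda>n. (T ^^ n) x)" "N (\<lambda>v. g v - f v) < r"
      using closure_of_normD[of f "range (\<lambda>n. (T ^^ n) x)" r] unfolding x(2) by metis
    from g(1) obtain n where "g = (T ^^ n) x" by (elim rangeE)
    with g(2) show "\<exists>n. N (\<lambda>v. (T ^^ n) x v - f v) < r" by blast
  qed
qed

section \<open>Choice of index sequences\<close>

text \<open>Each \<open>P k\<close> has arbitrarily large witnesses, so the next one can be taken
  beyond the previous one.\<close>

lemma strict_mono_choice:
  assumes "\<And>k M :: nat. \<exists>n\<ge>M. P k n"
  shows "\<exists>n :: nat \<Rightarrow> nat. strict_mono n \<and> (\<forall>k. 0 < n k) \<and> (\<forall>k. P k (n k))"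
proof -
  have "\<exists>n. \<forall>k. (0 < n k \<and> P k (n k)) \<and> n k < n (Suc k)"
  proof (rule dependent_nat_choice)
    show "\<exists>n. 0 < n \<and> P 0 n" using assms[of "Suc 0" 0] by (auto simp: Suc_le_eq)
    show "\<exists>n'. (0 < n' \<and> P (Suc k) n') \<and> n < n'" for n k
      using assms[of "Suc n" "Suc k"] by (auto simp: Suc_le_eq intro: le_less_trans)
  qed
  then show ?thesis by (auto simp: strict_mono_Suc_iff)
qed

text \<open>The threshold \<open>K\<close> allows for diagonal choices, where the estimate for
  column \<open>j\<close> holds only from \<open>k = j\<close> on.\<close>

lemma tendsto_0_if_less_inverse_Suc:
  fixes a :: "nat \<Rightarrow> real"
  assumes "\<And>k. 0 \<le> a k" "\<And>k. k \<ge> K \<Longrightarrow> a k < inverse (Suc k)"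
  shows "a \<longlonglongrightarrow> 0"
proof (rule tendsto_sandwich[OF _ _ tendsto_const LIMSEQ_inverse_real_of_nat])
  show "\<forall>\<^sub>F k in sequentially. 0 \<le> a k" using assms(1) by simp
  show "\<forall>\<^sub>F k in sequentially. a k \<le> inverse (real (Suc k))"
    unfolding eventually_sequentially using assms(2) less_imp_le by blast
qed

section \<open>The grid\<close>

lemma Chi_grid:
  "Chi (grid_edges m) (i, j) = (if (i, j) \<in> grid_verts m
     then insert (i, Suc j) (if i < m then {(Suc i, j)} else {}) else {})"
  by (auto simp: Chi_def grid_edges_def grid_verts_def)

lemma backward_shift_suminf:
  fixes h :: "nat \<Rightarrow> 'v \<Rightarrow> complex"
  assumes "\<And>v. summable (\<lambda>k. h k v)"
  shows "backward_shift E (\<lambda>v. \<Sum>k. h k v) = (\<lambda>v. \<Sum>k. backward_shift E (h k) v)"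
  unfolding backward_shift_def by (intro ext suminf_sum[symmetric] assms)

text \<open>The right inverse of the backward shift that vanishes on the first column; it is determined
  column by column from \<open>(B g)(i, q) = g(i, q + 1) + g(i + 1, q)\<close>.\<close>

primrec right_inverse_column :: "nat \<Rightarrow> (nat \<times> nat \<Rightarrow> complex) \<Rightarrow> nat \<Rightarrow> nat \<Rightarrow> complex" where
  "right_inverse_column m y 0 i = 0"
| "right_inverse_column m y (Suc q) i =
     (if i \<in> {1..m} then y (i, q) - right_inverse_column m y q (Suc i) else 0)"

definition right_inverse :: "nat \<Rightarrow> (nat \<times> nat \<Rightarrow> complex) \<Rightarrow> nat \<times> nat \<Rightarrow> complex" where
  "right_inverse m y = (\<lambda>(i, q). right_inverse_column m y q i)"

lemma right_inverse_0 [simp]: "right_inverse m y (i, 0) = 0"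
  by (simp add: right_inverse_def)

lemma right_inverse_Suc:
  "right_inverse m y (i, Suc q) =
     (if i \<in> {1..m} then y (i, q) - right_inverse m y (Suc i, q) else 0)"
  by (simp add: right_inverse_def)

lemma right_inverse_row_outside: "i \<notin> {1..m} \<Longrightarrow> right_inverse m y (i, q) = 0"
  by (cases q) (simp_all only: right_inverse_0 right_inverse_Suc if_False)

lemma right_inverse_outside: "v \<notin> grid_verts m \<Longrightarrow> right_inverse m y v = 0"
  using right_inverse_row_outside[of "fst v" m y "snd v"]
  by (cases v; cases "snd v") (auto simp: grid_verts_def)

text \<open>At \<open>(i, q)\<close> the shift adds back the value at \<open>(Suc i, q)\<close> that
  the recursion subtracted. In row \<open>m\<close> that value is 0, in agreement with the missing
  edge.\<close>

lemma backward_shift_right_inverse: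
  assumes "\<And>v. v \<notin> grid_verts m \<Longrightarrow> y v = 0"
  shows "backward_shift (grid_edges m) (right_inverse m y) = y"
proof
  fix v :: "nat \<times> nat"
  obtain i j where v: "v = (i, j)" by force
  show "backward_shift (grid_edges m) (right_inverse m y) v = y v"
  proof (cases "v \<in> grid_verts m")
    case True
    then show ?thesis
      using right_inverse_row_outside[of "Suc i" m y j]
      by (auto simp: backward_shift_def Chi_grid v right_inverse_Suc grid_verts_def)
  qed (simp add: assms backward_shift_def Chi_grid v)
qed

section \<open>Support and growth of the powers of the right inverse\<close>

lemma right_inverse_pow_outside:
  assumes "\<And>v. v \<notin> grid_verts m \<Longrightarrow> y v = 0" "v \<notin> grid_verts m"
  shows "(right_inverse m ^^ n) y v = 0"
  using assms by (cases n) (auto simp: right_inverse_outside)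

lemma backward_shift_pow_right_inverse_pow:
  assumes "\<And>v. v \<notin> grid_verts m \<Longrightarrow> y v = 0"
  shows "(backward_shift (grid_edges m) ^^ n) ((right_inverse m ^^ n) y) = y"
proof (induction n)
  case (Suc n)
  have "backward_shift (grid_edges m) (right_inverse m ((right_inverse m ^^ n) y))
      = (right_inverse m ^^ n) y"
    by (intro backward_shift_right_inverse right_inverse_pow_outside assms)
  then show ?case using Suc by (simp add: funpow_swap1)
qed simp

text \<open>Every application clears at least one more column on the left.\<close>

lemma right_inverse_pow_eq_0_left:
  assumes "\<And>v. v \<notin> grid_verts m \<Longrightarrow> y v = 0" "q \<le> n"
  shows "(right_inverse m ^^ n) y (i, q) = 0"
  using assms(2)
proof (induction n arbitrary: q i)
  case 0
  then show ?case using assms(1)[of "(i, q)"] by (auto simp: grid_verts_def)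
next
  case (Suc n)
  have "right_inverse m ((right_inverse m ^^ n) y) (i, q) = 0"
    using Suc.prems
    by (induction q arbitrary: i) (auto simp: right_inverse_Suc Suc.IH)
  then show ?case by simp
qed

text \<open>The recursion for \<open>(i, Suc q)\<close> refers to the argument at
  \<open>(i, q)\<close>, one antidiagonal lower, and to the result at \<open>(Suc i, q)\<close>, on
  the same antidiagonal. So the largest \<open>i + q\<close> in the support grows by at most 1 per
  application.\<close>

lemma right_inverse_pow_eq_0_right:
  assumes "\<And>i q. i + q > b \<Longrightarrow> y (i, q) = 0" "i + q > b + n"
  shows "(right_inverse m ^^ n) y (i, q) = 0"
  using assms(2)
proof (induction n arbitrary: q i)
  case 0
  then show ?case using assms(1) by auto
next
  case (Suc n)
  have "right_inverse m ((right_inverse m ^^ n) y) (i, q) = 0"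
    using Suc.prems
    by (induction q arbitrary: i) (auto simp: right_inverse_Suc Suc.IH)
  then show ?case by simp
qed

text \<open>In row \<open>m\<close> the right inverse is a pure translation, and each row above it
  accumulates one more power of \<open>n\<close>. The outer induction is on the number of
  applications, the inner one on the column.\<close>

lemma right_inverse_pow_bound:
  assumes "\<And>v. norm (y v) \<le> K" "i \<in> {1..m}"
  shows "norm ((right_inverse m ^^ n) y (i, q)) \<le> K * real (Suc n) ^ (m - i)"
  using assms(2)
proof (induction n arbitrary: q i)
  case 0
  then show ?case using assms(1) by simp
next
  case (Suc n)
  note IH = Suc.IH
  have K: "K \<ge> 0" using assms(1) norm_ge_zero order_trans by blast
  have "norm (right_inverse m ((right_inverse m ^^ n) y) (i, q)) \<le> K * real (Suc (Suc n)) ^ (m - i)"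
    using Suc.prems
  proof (induction q arbitrary: i)
    case 0
    then show ?case using K by simp
  next
    case (Suc q)
    let ?z = "(right_inverse m ^^ n) y"
    have z: "norm (?z (i, q)) \<le> K * real (Suc n) ^ (m - i)" using Suc.prems by (rule IH)
    show ?case
    proof (cases "i = m")
      case True
      then show ?thesis
        using z Suc.prems by (simp add: right_inverse_Suc right_inverse_row_outside)
    next
      case False
      then obtain d where d: "m - i = Suc d" "m - Suc i = d"
        using Suc.prems by (metis Suc_diff_Suc atLeastAtMost_iff le_neq_implies_less)
      have "norm (right_inverse m ?z (i, Suc q)) \<le> norm (?z (i, q)) + norm (right_inverse m ?z (Suc i, q))"
        using Suc.prems by (simp add: right_inverse_Suc norm_triangle_ineq4)
      also have "\<dots> \<le> K * real (Suc n) ^ Suc d + K * real (Suc (Suc n)) ^ d"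
        using z Suc.IH[of "Suc i"] False Suc.prems d by (intro add_mono) auto
      also have "\<dots> = K * (real (Suc n) * real (Suc n) ^ d + real (Suc (Suc n)) ^ d)"
        by (simp add: algebra_simps)
      \<comment> \<open>Raising the base in the first term makes the two terms combine to exactly
        \<open>Suc d\<close> factors of \<open>Suc (Suc n)\<close>.\<close>
      also have "\<dots> \<le> K * (real (Suc n) * real (Suc (Suc n)) ^ d + real (Suc (Suc n)) ^ d)"
        using K by (intro mult_left_mono add_right_mono power_mono) auto
      also have "\<dots> = K * real (Suc (Suc n)) ^ (m - i)" by (simp add: d algebra_simps)
      finally show ?thesis .
    qed
  qed
  then show ?case by simp
qed

section \<open>The bounded shift on the grid and its powers\<close>

locale grid_shift = complete_weighted_space "grid_verts m" \<mu> X N for m \<mu> X N +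
  assumes m: "m \<ge> 1"
    and bounded: "bounded_operator_on X N (backward_shift (grid_edges m))"
begin

abbreviation "V \<equiv> grid_verts m"
abbreviation "B \<equiv> backward_shift (grid_edges m)"
abbreviation "R \<equiv> right_inverse m"

lemma B_apply:
  assumes "f \<in> X" "(i, j) \<in> V"
  shows "B f (i, j) = f (i, Suc j) + f (Suc i, j)"
  using assms(2) space_vanish[OF assms(1), of "(Suc i, j)"]
  by (auto simp: backward_shift_def Chi_grid grid_verts_def)

lemma B_in_space: "f \<in> X \<Longrightarrow> B f \<in> X"
  using bounded by (simp add: bounded_operator_on_def)

lemma B_pow_in_space: "f \<in> X \<Longrightarrow> (B ^^ n) f \<in> X"
  by (induction n) (auto simp: B_in_space)

text \<open>An operator bound of size at least 1, so that \<open>C ^ n\<close> increases with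
  \<open>n\<close>.\<close>

definition C :: real where
  "C = (SOME C. C \<ge> 1 \<and> (\<forall>f\<in>X. N (B f) \<le> C * N f))"

lemma C: "C \<ge> 1" "f \<in> X \<Longrightarrow> N (B f) \<le> C * N f"
proof -
  obtain c where "\<forall>f\<in>X. N (B f) \<le> c * N f"
    using bounded unfolding bounded_operator_on_def by (elim conjE exE)
  then have c: "N (B f) \<le> c * N f" if "f \<in> X" for f using that by blast
  have "N (B f) \<le> max 1 c * N f" if "f \<in> X" for f
    using c[OF that] mult_right_mono[of c "max 1 c" "N f"] norm_nonneg[OF that] by simp
  then have "\<exists>C\<ge>1. \<forall>f\<in>X. N (B f) \<le> C * N f" by (intro exI[of _ "max 1 c"]) auto
  then have *: "C \<ge> 1 \<and> (\<forall>f\<in>X. N (B f) \<le> C * N f)" unfolding C_def by (rule someI_ex)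
  then show "C \<ge> 1" ..
  show "N (B f) \<le> C * N f" if "f \<in> X" using * that by blast
qed

lemma B_pow_norm_le: 
  assumes "f \<in> X"
  shows "N ((B ^^ n) f) \<le> C ^ n * N f"
proof (induction n)
  case (Suc n)
  have "N (B ((B ^^ n) f)) \<le> C * N ((B ^^ n) f)" by (rule C(2)[OF B_pow_in_space[OF assms]])
  also have "\<dots> \<le> C * (C ^ n * N f)" using Suc C(1) by (intro mult_left_mono) auto
  finally show ?case by (simp add: mult.assoc)
qed simp

text \<open>The images under \<open>B ^^ n\<close> are again dominated by a summable sequence,
  namely \<open>C ^ n * a k\<close>, so all coordinate series converge and the shift passes through
  them one step at a time.\<close>

lemma B_pow_suminf:
  assumes "\<And>k. g k \<in> X" "\<And>k. N (g k) \<le> a k" "summable a"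
  shows "(B ^^ n) (\<lambda>v. \<Sum>k. g k v) = (\<lambda>v. \<Sum>k. (B ^^ n) (g k) v)"
proof (induction n)
  case (Suc n)
  have "N ((B ^^ n) (g k)) \<le> C ^ n * a k" for k
    using C(1) by (intro order_trans[OF B_pow_norm_le] mult_left_mono assms) auto
  then have "summable (\<lambda>k. (B ^^ n) (g k) v)" for v
    by (rule summable_coords[OF B_pow_in_space[OF assms(1)] _ summable_mult[OF assms(3)]])
  then show ?case by (simp add: Suc backward_shift_suminf)
qed simp

text \<open>The value of \<open>B f\<close> at \<open>(i, q)\<close> involves only the next
  antidiagonal of \<open>f\<close>, so each application lowers the largest \<open>i + q\<close> in
  the support by at least 1. Vertices have \<open>i + q \<ge> 2\<close>, hence nothing is left after
  \<open>b\<close> steps.\<close>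

lemma B_pow_eq_0:
  assumes "\<And>i q. i + q > b \<Longrightarrow> y (i, q) = 0" "n \<ge> b" "y \<in> X"
  shows "(B ^^ n) y = (\<lambda>v. 0)"
proof -
  have supp: "(B ^^ n) y (i, q) = 0" if "i + q + n > b" for n i q
    using that
  proof (induction n arbitrary: i q)
    case 0
    then show ?case using assms(1) by simp
  next
    case (Suc n)
    have "B ((B ^^ n) y) (i, q) = 0"
      using B_apply[OF B_pow_in_space[OF assms(3)], of i q n] Suc
        space_vanish[OF B_pow_in_space[OF assms(3)], of "(i, q)" "Suc n"]
      by (cases "(i, q) \<in> V") auto
    then show ?case by simp
  qed
  show ?thesis
  proof
    fix v :: "nat \<times> nat"
    obtain i q where v: "v = (i, q)" by force
    show "(B ^^ n) y v = 0"
    proof (cases "v \<in> V")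
      case True
      then show ?thesis using assms(2) unfolding v by (intro supp) (auto simp: grid_verts_def)
    qed (rule space_vanish[OF B_pow_in_space[OF assms(3)]])
  qed
qed

subsection \<open>Necessity\<close>

text \<open>With alternating signs the recursion \<open>f(i, q + 1) = (B f)(i, q) - f(i + 1, q)\<close> becomes Pascal's
  rule, so nothing can cancel.\<close>

lemma binomial_lower_bound:
  assumes "f \<in> X"
    and "\<And>i d q. \<lbrakk>i + d = m; 1 \<le> i; 1 \<le> q; q \<le> m\<rbrakk> \<Longrightarrow> 1 \<le> Re ((-1) ^ d * (B ^^ n) f (i, q))"
    and "i + d = m" "1 \<le> i" "d < q" "q \<le> m"
  shows "real ((n + d) choose d) \<le> Re ((-1) ^ d * f (i, n + q))"
  using assms
proof (induction n arbitrary: f i d q)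
  case 0
  then show ?case by auto
next
  case (Suc n)
  have IH: "real ((n + d) choose d) \<le> Re ((-1) ^ d * B f (i, n + q))"
    if "i + d = m" "1 \<le> i" "d < q" "q \<le> m" for i d q
    using Suc.prems(1,2) that by (intro Suc.IH B_in_space) (auto simp: funpow_swap1)
  show ?case
    using Suc.prems(3-6)
  proof (induction d arbitrary: i q)
    case 0
    then have "f (i, Suc (n + q)) = B f (i, n + q)"
      using B_apply[OF Suc.prems(1), of i "n + q"] space_vanish[OF Suc.prems(1), of "(Suc i, n + q)"]
      by (auto simp: grid_verts_def)
    then show ?case using IH[of i 0 q] 0 by simp
  next
    case (Suc d)
    \<comment> \<open>Passing to row \<open>Suc i\<close> lowers \<open>d\<close> and
      \<open>q\<close> together, which preserves \<open>d < q\<close> and keeps the column in the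
      range of the hypothesis.\<close>
    obtain q' where q: "q = Suc q'" using Suc.prems by (cases q) auto
    have "B f (i, n + q) = f (i, Suc (n + q)) + f (Suc i, n + q)"
      using Suc.prems by (intro B_apply assms \<open>f \<in> X\<close>) (auto simp: grid_verts_def)
    \<comment> \<open>The sign turns the difference into a sum, so the outer and the inner induction
      hypotheses add up by Pascal's rule.\<close>
    then have "(-1) ^ Suc d * f (i, Suc (n + q))
        = (-1) ^ Suc d * B f (i, n + q) + (-1) ^ d * f (Suc i, Suc n + q')"
      by (simp add: q algebra_simps)
    moreover have "real ((n + Suc d) choose Suc d) \<le> Re ((-1) ^ Suc d * B f (i, n + q))"
      using Suc.prems by (intro IH) auto
    moreover have "real ((Suc n + d) choose d) \<le> Re ((-1) ^ d * f (Suc i, Suc n + q'))"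
      using Suc.prems q by (intro Suc.IH) auto
    ultimately show ?case by simp
  qed
qed

text \<open>Combines \<open>((n + d) / d) ^ d \<le> (n + d) choose d\<close> with
  \<open>(n + m) / m \<le> (n + d) / d\<close>. The constant \<open>m ^ m\<close> is uniform in
  \<open>d\<close>, and the base is \<open>n + m\<close> because that is the column examined
  below.\<close>

lemma power_le_binomial:
  assumes "d \<le> m"
  shows "real (n + m) ^ d \<le> real m ^ m * real ((n + d) choose d)"
proof (cases "d = 0")
  case False
  have "real (n + m) / m \<le> real (n + d) / d"
    using assms False m by (simp add: field_simps mult_right_mono)
  then have "(real (n + m) / m) ^ d \<le> (real (n + d) / d) ^ d" by (intro power_mono) auto
  also have "\<dots> \<le> real ((n + d) choose d)" by (rule binomial_ge_n_over_k_pow_k) simp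
  finally have "real (n + m) ^ d \<le> real m ^ d * real ((n + d) choose d)"
    using m by (simp add: power_divide field_simps)
  also have "\<dots> \<le> real m ^ m * real ((n + d) choose d)"
    using assms m by (intro mult_right_mono power_increasing) auto
  finally show ?thesis .
qed (use m in simp)

lemma necessity:
  assumes "hypercyclic (norm_topology X N) B" "\<epsilon> > 0"
  shows "\<exists>n\<ge>M. \<forall>i\<in>{1..m}. real n ^ (m - i) * norm (\<mu> (i, n)) < \<epsilon>"
proof -
  obtain x where x: "x \<in> X" "\<And>f r. \<lbrakk>f \<in> X; r > 0\<rbrakk> \<Longrightarrow> \<exists>n. N (\<lambda>v. (B ^^ n) x v - f v) < r"
    using hypercyclicD[OF assms(1)] by blast
  \<comment> \<open>Compensates the factor \<open>m ^ m\<close> from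
    \<open>power_le_binomial\<close>.\<close>
  define \<delta> where "\<delta> = \<epsilon> / real m ^ m"
  have \<delta>: "\<delta> > 0" using assms(2) m by (simp add: \<delta>_def)
  \<comment> \<open>Only finitely many weighted coordinates of \<open>x\<close> reach
    \<open>\<delta>\<close>, so they all lie left of some column.\<close>
  obtain M' where M': "\<And>i q. \<lbrakk>(i, q) \<in> V; q \<ge> M'\<rbrakk> \<Longrightarrow> norm (x (i, q) * \<mu> (i, q)) < \<delta>"
  proof -
    have "finite (snd ` {v \<in> V. \<delta> \<le> norm (x v * \<mu> v)})"
      using finite_coords_ge[OF x(1) \<delta>] by simp
    then obtain K where K: "\<forall>q\<in>snd ` {v \<in> V. \<delta> \<le> norm (x v * \<mu> v)}. q \<le> K"
      unfolding finite_nat_set_iff_bounded_le by (elim exE)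
    have "norm (x (i, q) * \<mu> (i, q)) < \<delta>" if iq: "(i, q) \<in> V" "q \<ge> Suc K" for i q
    proof (rule ccontr)
      assume "\<not> ?thesis"
      then have "(i, q) \<in> {v \<in> V. \<delta> \<le> norm (x v * \<mu> v)}" using iq(1) by simp
      from imageI[OF this, of snd] K have "q \<le> K" by auto
      then show False using iq(2) by simp
    qed
    then show thesis by (rule that)
  qed
  define L where "L = max M M'"
  \<comment> \<open>A target of size larger than the first \<open>L\<close> terms of the orbit forces \<open>n \<ge> L\<close>.\<close>
  define t where "t = 2 + (\<Sum>n<L. norm ((B ^^ n) x (m, 1)))"
  have t: "t \<ge> 2" by (simp add: t_def sum_nonneg)
  \<comment> \<open>The lower bound in row \<open>i\<close> at \<open>q = m\<close> descends through
    the lower rows and uses the target on columns up to \<open>m\<close>; a square block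
    suffices.\<close>
  define W where "W = {1..m} \<times> {1..m}"
  have W: "finite W" "W \<noteq> {}" "W \<subseteq> V" using m by (auto simp: W_def grid_verts_def)
  define y where "y = (\<lambda>v. if v \<in> W then (-1) ^ (m - fst v) * complex_of_real t else 0)"
  have y: "y \<in> X" using finsupp_in_space[OF W(1,3), of y] by (simp add: y_def)
  \<comment> \<open>Distance below the smallest weight on \<open>W\<close> means an error below 1 in
    each entry there.\<close>
  define r where "r = Min ((\<lambda>v. norm (\<mu> v)) ` W)"
  have r: "r > 0" using W weight_nz by (auto simp: r_def)
  obtain n where n: "N (\<lambda>v. (B ^^ n) x v - y v) < r" using x(2)[OF y r] by blast
  have near: "norm ((B ^^ n) x v - y v) < 1" if "v \<in> W" for v
  proof -
    have v: "v \<in> V" "r \<le> norm (\<mu> v)" using W that by (auto simp: r_def)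
    have "norm ((B ^^ n) x v - y v) * norm (\<mu> v) < norm (\<mu> v)"
      using norm_coord[OF space_diff[OF B_pow_in_space[OF x(1)] y] v(1), of n] n v(2)
      by (simp add: norm_mult)
    then show ?thesis using weight_nz[OF v(1)] by simp
  qed
  have ge1: "1 \<le> Re ((-1) ^ d * (B ^^ n) x (i, q))"
    if "i + d = m" "1 \<le> i" "1 \<le> q" "q \<le> m" for i d q
  proof -
    have iq: "(i, q) \<in> W" using that by (auto simp: W_def)
    have y_iq: "y (i, q) = (-1) ^ d * complex_of_real t" using iq that(1) by (auto simp: y_def)
    \<comment> \<open>The two signs cancel, so the signed entry lies within 1 of \<open>t\<close>,
      which is at least 2.\<close>
    have "(-1) ^ d * (B ^^ n) x (i, q) - t = (-1) ^ d * ((B ^^ n) x (i, q) - y (i, q))"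
      by (simp add: y_iq right_diff_distrib flip: power_mult_distrib mult.assoc)
    then have "norm ((-1) ^ d * (B ^^ n) x (i, q) - t) < 1"
      using near[OF iq] by (simp add: norm_mult norm_power)
    then have "\<bar>Re ((-1) ^ d * (B ^^ n) x (i, q) - t)\<bar> < 1"
      using abs_Re_le_cmod le_less_trans by blast
    then show ?thesis using t by auto
  qed
  have "n \<ge> L"
  proof (rule ccontr)
    assume "\<not> n \<ge> L"
    then have "norm ((B ^^ n) x (m, 1)) \<le> (\<Sum>n<L. norm ((B ^^ n) x (m, 1)))"
      by (intro member_le_sum) auto
    then have "norm ((B ^^ n) x (m, 1)) \<le> t - 2" by (simp add: t_def)
    moreover have m1: "(m, 1) \<in> W" using m by (auto simp: W_def)
    then have "y (m, 1) = t" by (simp add: y_def)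
    then have "norm (y (m, 1)) = t" using t by simp
    ultimately show False
      using near[OF m1] norm_triangle_ineq3[of "(B ^^ n) x (m, 1)" "y (m, 1)"] by linarith
  qed
  have "real (n + m) ^ (m - i) * norm (\<mu> (i, n + m)) < \<epsilon>" if i: "i \<in> {1..m}" for i
  proof -
    define d where "d = m - i"
    have d: "i + d = m" "d < m" using i by (auto simp: d_def)
    have v: "(i, n + m) \<in> V" using i by (auto simp: grid_verts_def)
    have "real ((n + d) choose d) \<le> Re ((-1) ^ d * x (i, n + m))"
      using i d by (intro binomial_lower_bound x(1) ge1) auto
    also have "\<dots> \<le> norm (x (i, n + m))"
      using complex_Re_le_cmod[of "(-1) ^ d * x (i, n + m)"] by (simp add: norm_mult norm_power)
    finally have "real (n + m) ^ d \<le> real m ^ m * norm (x (i, n + m))"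
      using power_le_binomial[of d n] d mult_left_mono[of _ "norm (x (i, n + m))" "real m ^ m"]
      by (meson less_imp_le of_nat_0_le_iff order_trans zero_le_power)
    then have "real (n + m) ^ d * norm (\<mu> (i, n + m))
        \<le> real m ^ m * norm (x (i, n + m)) * norm (\<mu> (i, n + m))"
      by (rule mult_right_mono) simp
    also have "\<dots> = real m ^ m * norm (x (i, n + m) * \<mu> (i, n + m))"
      by (simp add: norm_mult)
    also have "\<dots> < real m ^ m * \<delta>"
      using M'[OF v] \<open>n \<ge> L\<close> m by (intro mult_strict_left_mono) (auto simp: L_def)
    also have "\<dots> = \<epsilon>" using m by (simp add: \<delta>_def)
    finally show ?thesis by (simp add: d_def)
  qed
  then show ?thesis using \<open>n \<ge> L\<close> by (intro exI[of _ "n + m"]) (auto simp: L_def)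
qed

section \<open>Comparison of weights along a row\<close>

text \<open>The shift of the unit vector at the next column takes the value 1 at
  \<open>(i, j + r)\<close>; boundedness compares the two weights, and iteration gives the power of
  \<open>C\<close>.\<close>

lemma weight_le_shifted:
  assumes "(i, j) \<in> V"
  shows "norm (\<mu> (i, j)) \<le> C ^ r * norm (\<mu> (i, j + r))"
proof (induction r)
  case (Suc r)
  let ?u = "(i, Suc (j + r))"
  have V: "?u \<in> V" "(i, j + r) \<in> V" using assms by (auto simp: grid_verts_def)
  have "B (unit_at ?u) (i, j + r) = 1"
    using B_apply[OF space_unit[OF V(1)] V(2)] by simp
  then have "norm (\<mu> (i, j + r)) \<le> N (B (unit_at ?u))"
    using norm_coord[OF B_in_space[OF space_unit[OF V(1)]] V(2)] by simp
  also have "\<dots> \<le> C * norm (\<mu> ?u)"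
    using C(1) by (intro order_trans[OF C(2)] mult_left_mono space_unit norm_unit V(1)) auto
  finally have "C ^ r * norm (\<mu> (i, j + r)) \<le> C ^ r * (C * norm (\<mu> ?u))"
    using C(1) by (intro mult_left_mono) auto
  with Suc show ?case by (simp add: mult_ac)
qed simp

text \<open>Start from a column \<open>n\<close> that is good for \<open>\<epsilon> / C ^ K\<close>
  and step back to \<open>n - K\<close>. For \<open>j \<le> K\<close> the column
  \<open>j + (n - K)\<close> is \<open>K - j\<close> places left of \<open>n\<close>, so
  \<open>weight_le_shifted\<close> costs at most \<open>C ^ K\<close>.\<close>

lemma column_condition_shift:
  assumes "\<And>\<epsilon> M. \<epsilon> > 0 \<Longrightarrow> \<exists>n\<ge>M. \<forall>i\<in>{1..m}. real n ^ (m - i) * norm (\<mu> (i, n)) < \<epsilon>"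
    and "\<epsilon> > 0"
  shows "\<exists>n\<ge>M. \<forall>i\<in>{1..m}. \<forall>j\<in>{1..K}. real n ^ (m - i) * norm (\<mu> (i, j + n)) < \<epsilon>"
proof -
  have CK: "C ^ K > 0" using C(1) by simp
  obtain n where n: "n \<ge> M + K" "\<And>i. i \<in> {1..m} \<Longrightarrow> real n ^ (m - i) * norm (\<mu> (i, n)) < \<epsilon> / C ^ K"
    using assms(1)[of "\<epsilon> / C ^ K" "M + K"] assms(2) CK by auto
  have "real (n - K) ^ (m - i) * norm (\<mu> (i, j + (n - K))) < \<epsilon>"
    if i: "i \<in> {1..m}" and j: "j \<in> {1..K}" for i j
  proof -
    have "norm (\<mu> (i, j + (n - K))) \<le> C ^ (K - j) * norm (\<mu> (i, j + (n - K) + (K - j)))"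
      using i j by (intro weight_le_shifted) (auto simp: grid_verts_def)
    also have "j + (n - K) + (K - j) = n" using n(1) j by auto
    also have "C ^ (K - j) * norm (\<mu> (i, n)) \<le> C ^ K * norm (\<mu> (i, n))"
      using C(1) by (intro mult_right_mono power_increasing) auto
    finally have "real (n - K) ^ (m - i) * norm (\<mu> (i, j + (n - K)))
        \<le> real n ^ (m - i) * (C ^ K * norm (\<mu> (i, n)))"
      using C(1) by (intro mult_mono power_mono) auto
    also have "\<dots> = C ^ K * (real n ^ (m - i) * norm (\<mu> (i, n)))" by simp
    also have "\<dots> < C ^ K * (\<epsilon> / C ^ K)" by (intro mult_strict_left_mono n(2) i CK)
    finally show ?thesis using CK C(1) by simp
  qed
  then show ?thesis using n(1) by (intro exI[of _ "n - K"]) auto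
qed

subsection \<open>Sufficiency\<close>

text \<open>The support of \<open>(R ^^ k) y\<close> stays in a window of fixed size translated by
  \<open>k\<close> columns. The growth of the entries is exactly what the weight condition
  compensates, and the number of terms does not depend on \<open>k\<close>.\<close>

lemma R_pow_norm_tendsto_0:
  assumes n: "strict_mono n" "\<And>k. 0 < n k"
    and lim: "\<And>i j. \<lbrakk>i \<in> {1..m}; j \<ge> 1\<rbrakk> \<Longrightarrow>
      (\<lambda>k. real (n k) ^ (m - i) * norm (\<mu> (i, j + n k))) \<longlonglongrightarrow> 0"
    and y: "finite {v. y v \<noteq> 0}" "{v. y v \<noteq> 0} \<subseteq> V"
  shows "(R ^^ k) y \<in> X" "(\<lambda>k. N ((R ^^ n k) y)) \<longlonglongrightarrow> 0"
proof -
  have yV: "y v = 0" if "v \<notin> V" for v using y(2) that by blast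
  obtain b where b: "\<And>i q. i + q > b \<Longrightarrow> y (i, q) = 0"
  proof -
    obtain b where "\<forall>s\<in>(\<lambda>(i, q). i + q) ` {v. y v \<noteq> 0}. s \<le> b"
      using finite_imageI[OF y(1), of "\<lambda>(i, q). i + q"]
      unfolding finite_nat_set_iff_bounded_le by (elim exE)
    then show thesis by (intro that[of b]) force
  qed
  obtain K where K: "\<And>v. norm (y v) \<le> K"
  proof (rule that)
    show "norm (y v) \<le> (\<Sum>v\<in>{v. y v \<noteq> 0}. norm (y v))" for v
      using y(1) by (cases "y v = 0") (auto intro: member_le_sum sum_nonneg)
  qed
  have K0: "K \<ge> 0" using K norm_ge_zero order_trans by blast
  define F where "F = (\<lambda>k. (\<lambda>(i, j). (i, j + k)) ` ({1..m} \<times> {1..b}))"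
  have F: "finite (F k)" "F k \<subseteq> V" for k by (auto simp: F_def grid_verts_def)
  have supp: "(R ^^ k) y v = 0" if "v \<notin> F k" for v k
  proof -
    obtain i q where v: "v = (i, q)" by force
    show ?thesis
    proof (rule ccontr)
      assume nz: "(R ^^ k) y v \<noteq> 0"
      have "v \<in> V"
      proof (rule ccontr)
        assume "v \<notin> V"
        from right_inverse_pow_outside[where y = y, OF yV this, of k] nz show False by simp
      qed
      moreover have "\<not> q \<le> k"
      proof
        assume "q \<le> k"
        from right_inverse_pow_eq_0_left[where y = y and m = m, OF yV this, of i] nz v show False by simp
      qed
      moreover have "\<not> i + q > b + k"
      proof
        assume "i + q > b + k"
        from right_inverse_pow_eq_0_right[where y = y and m = m, OF b this] nz v show False by simp
      qed
      ultimately have "v \<in> F k"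
        unfolding F_def v by (intro image_eqI[of _ _ "(i, q - k)"]) (auto simp: grid_verts_def)
      with that show False by blast
    qed
  qed
  have space: "(R ^^ k) y \<in> X \<and> N ((R ^^ k) y) \<le> (\<Sum>v\<in>F k. norm ((R ^^ k) y v) * norm (\<mu> v))" for k
    by (rule finsupp_in_space[OF F]) (rule supp)
  show "(R ^^ k) y \<in> X" for k using space by blast
  have bound: "N ((R ^^ n k) y) \<le>
      (\<Sum>(i, j)\<in>{1..m} \<times> {1..b}. (K * 2 ^ m) * (real (n k) ^ (m - i) * norm (\<mu> (i, j + n k))))" for k
  proof -
    have "N ((R ^^ n k) y) \<le> (\<Sum>v\<in>F (n k). norm ((R ^^ n k) y v) * norm (\<mu> v))"
      using space by blast
    also have "\<dots> = (\<Sum>(i, j)\<in>{1..m} \<times> {1..b}. norm ((R ^^ n k) y (i, j + n k)) * norm (\<mu> (i, j + n k)))"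
      unfolding F_def by (subst sum.reindex) (auto simp: inj_on_def case_prod_beta)
    also have "\<dots> \<le> (\<Sum>(i, j)\<in>{1..m} \<times> {1..b}.
        (K * 2 ^ m) * (real (n k) ^ (m - i) * norm (\<mu> (i, j + n k))))"
    proof (rule sum_mono, clarify)
      fix i j assume i: "i \<in> {1..m}"
      have "norm ((R ^^ n k) y (i, j + n k)) \<le> K * real (Suc (n k)) ^ (m - i)"
        by (rule right_inverse_pow_bound[OF K i])
      \<comment> \<open>Positivity of \<open>n k\<close> gives
        \<open>Suc (n k) \<le> 2 * n k\<close>.\<close>
      also have "\<dots> \<le> K * (2 * real (n k)) ^ (m - i)"
        using n(2)[of k] K0 by (intro mult_left_mono power_mono) auto
      also have "\<dots> = K * (2 ^ (m - i) * real (n k) ^ (m - i))" by (simp add: power_mult_distrib)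
      also have "\<dots> \<le> K * (2 ^ m * real (n k) ^ (m - i))"
        using K0 by (intro mult_left_mono mult_right_mono power_increasing) auto
      finally have "norm ((R ^^ n k) y (i, j + n k)) * norm (\<mu> (i, j + n k))
          \<le> K * (2 ^ m * real (n k) ^ (m - i)) * norm (\<mu> (i, j + n k))"
        by (intro mult_right_mono) auto
      then show "norm ((R ^^ n k) y (i, j + n k)) * norm (\<mu> (i, j + n k))
          \<le> (K * 2 ^ m) * (real (n k) ^ (m - i) * norm (\<mu> (i, j + n k)))"
        by (simp add: mult.assoc)
    qed
    finally show ?thesis .
  qed
  have "(\<lambda>k. \<Sum>(i, j)\<in>{1..m} \<times> {1..b}. (K * 2 ^ m) * (real (n k) ^ (m - i) * norm (\<mu> (i, j + n k))))
      \<longlonglongrightarrow> (\<Sum>(i, j)\<in>{1..m} \<times> {1..b}. 0)"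
    unfolding case_prod_beta
    by (intro tendsto_sum tendsto_mult_right_zero lim) auto
  then have lim0: "(\<lambda>k. \<Sum>(i, j)\<in>{1..m} \<times> {1..b}. (K * 2 ^ m) * (real (n k) ^ (m - i) * norm (\<mu> (i, j + n k))))
      \<longlonglongrightarrow> 0" by simp
  show "(\<lambda>k. N ((R ^^ n k) y)) \<longlonglongrightarrow> 0"
  proof (rule tendsto_sandwich[OF _ _ tendsto_const lim0])
    show "\<forall>\<^sub>F k in sequentially. 0 \<le> N ((R ^^ n k) y)"
      using norm_nonneg[OF conjunct1[OF space]] by simp
  qed (use bound in simp)
qed

text \<open>Take \<open>x\<close> to be the sum of the vectors \<open>(R ^^ n k) (y k)\<close>.
  Under \<open>B ^^ n k\<close> the earlier terms have died out, the term of index \<open>k\<close>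
  becomes \<open>y k\<close>, and the later terms are too small to matter even after multiplication
  by \<open>C ^ n k\<close>.\<close>

lemma universal_series:
  assumes y: "\<And>k v. v \<notin> V \<Longrightarrow> y k v = 0" "\<And>k. y k \<in> X"
    and L: "\<And>k l. l \<ge> L k \<Longrightarrow> (B ^^ l) (y k) = (\<lambda>v. 0)"
    and R: "\<And>k l. (R ^^ l) (y k) \<in> X"
    and n: "\<And>k. n (Suc k) \<ge> n k + L k"
    and small: "\<And>k. N ((R ^^ n k) (y k)) \<le> (1/2) ^ k"
      "\<And>k. C ^ n k * N ((R ^^ n (Suc k)) (y (Suc k))) \<le> (1/2) ^ Suc k"
  shows "\<exists>x\<in>X. \<forall>k. N (\<lambda>v. (B ^^ n k) x v - y k v) \<le> (1/2) ^ k"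
proof -
  define h where "h = (\<lambda>k. (R ^^ n k) (y k))"
  have h: "h k \<in> X" "N (h k) \<le> (1/2) ^ k" for k using R small by (auto simp: h_def)
  have half: "summable (\<lambda>k. (1/2) ^ k :: real)" by (simp add: summable_geometric)
  define x where "x = (\<lambda>v. \<Sum>k. h k v)"
  have x: "x \<in> X" using series[of h "\<lambda>k. (1/2) ^ k"] h half by (simp add: x_def)
  have mono: "n j \<le> n k" if "j \<le> k" for j k
    by (rule lift_Suc_mono_le[where f = n, OF add_leD1[OF n] that])
  have B_R: "(B ^^ l) ((R ^^ l) (y k)) = y k" for k l
    by (rule backward_shift_pow_right_inverse_pow[OF y(1)])
  have past: "(B ^^ n k) (h j) = (\<lambda>v. 0)" if "j < k" for j k
  proof -
    have nk: "n k \<ge> n j + L j" using n[of j] mono[of "Suc j" k] that by simp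
    then have "(B ^^ n k) (h j) = (B ^^ (n k - n j)) ((B ^^ n j) (h j))"
      by (simp flip: funpow_add comp_apply[of "B ^^ (n k - n j)"])
    then show ?thesis using nk L by (simp add: h_def B_R)
  qed
  have future: "N ((B ^^ n k) (h (j + Suc k))) \<le> (1/2) ^ (j + Suc k)" for j k
  proof -
    have "N ((B ^^ n k) (h (j + Suc k))) \<le> C ^ n k * N (h (j + Suc k))"
      by (rule B_pow_norm_le[OF h(1)])
    \<comment> \<open>The smallness hypothesis links consecutive indices only; monotonicity of the
      powers of \<open>C\<close> extends it to all later terms.\<close>
    also have "\<dots> \<le> C ^ n (j + k) * N (h (j + Suc k))"
      using C(1) norm_nonneg[OF h(1)] mono[of k "j + k"] by (intro mult_right_mono power_increasing) auto
    also have "\<dots> \<le> (1/2) ^ (j + Suc k)" using small(2)[of "j + k"] by (simp add: h_def)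
    finally show ?thesis .
  qed
  have "N (\<lambda>v. (B ^^ n k) x v - y k v) \<le> (1/2) ^ k" for k
  proof -
    have sm: "summable (\<lambda>j. (B ^^ n k) (h j) v)" for v
    proof (rule summable_coords)
      show "N ((B ^^ n k) (h j)) \<le> C ^ n k * (1/2) ^ j" for j
        using C(1) by (intro order_trans[OF B_pow_norm_le] mult_left_mono h) auto
    qed (use half B_pow_in_space h in \<open>auto intro: summable_mult\<close>)
    have "(B ^^ n k) x = (\<lambda>v. \<Sum>j. (B ^^ n k) (h j) v)"
      unfolding x_def by (rule B_pow_suminf[OF h half])
    also have "\<dots> = (\<lambda>v. (\<Sum>j. (B ^^ n k) (h (j + Suc k)) v) + y k v)"
    proof
      fix v
      have "(\<Sum>j. (B ^^ n k) (h j) v)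
          = (\<Sum>j. (B ^^ n k) (h (j + Suc k)) v) + (\<Sum>j<Suc k. (B ^^ n k) (h j) v)"
        by (rule suminf_split_initial_segment[OF sm])
      also have "(\<Sum>j<Suc k. (B ^^ n k) (h j) v) = y k v"
        by (simp add: past) (simp add: h_def B_R)
      finally show "(\<Sum>j. (B ^^ n k) (h j) v) = (\<Sum>j. (B ^^ n k) (h (j + Suc k)) v) + y k v" .
    qed
    finally have "(\<lambda>v. (B ^^ n k) x v - y k v) = (\<lambda>v. \<Sum>j. (B ^^ n k) (h (j + Suc k)) v)"
      by simp
    moreover have "(\<lambda>j. (1/2) ^ (j + Suc k) :: real) sums (1/2) ^ k"
      using sums_mult2[OF geometric_sums[of "1/2 :: real"], of "(1/2) ^ Suc k"]
      by (simp add: power_add)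
    ultimately show ?thesis
      using series[of "\<lambda>j. (B ^^ n k) (h (j + Suc k))" "\<lambda>j. (1/2) ^ (j + Suc k)"] future[of k]
        B_pow_in_space[OF h(1)] by (simp add: sums_iff)
  qed
  then show ?thesis using x by blast
qed

lemma sufficiency:
  assumes n: "strict_mono n" "\<And>k. 0 < n k"
    and lim: "\<And>i j. \<lbrakk>i \<in> {1..m}; j \<ge> 1\<rbrakk> \<Longrightarrow>
      (\<lambda>k. real (n k) ^ (m - i) * norm (\<mu> (i, j + n k))) \<longlonglongrightarrow> 0"
  shows "weakly_mixing (norm_topology X N) B"
proof -
  obtain d :: "nat \<Rightarrow> nat \<times> nat \<Rightarrow> complex"
    where d: "\<And>k. finite {v. d k v \<noteq> 0}" "\<And>k. {v. d k v \<noteq> 0} \<subseteq> V"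
      "\<And>f r. \<lbrakk>f \<in> X; r > 0\<rbrakk> \<Longrightarrow> \<exists>k. N (\<lambda>v. d k v - f v) < r"
  proof -
    obtain y :: "nat \<Rightarrow> nat \<times> nat \<Rightarrow> complex" where "(\<forall>k. finite {v. y k v \<noteq> 0} \<and> {v. y k v \<noteq> 0} \<subseteq> V) \<and>
        (\<forall>f\<in>X. \<forall>r>0. \<exists>k. N (\<lambda>v. y k v - f v) < r)"
      using dense_sequence[OF countableI_type] by (elim exE) (rule that)
    then show thesis by (intro that[of y]) simp_all
  qed
  note R = R_pow_norm_tendsto_0[OF n lim d(1,2)]
  have dV: "d k v = 0" if "v \<notin> V" for k v using d(2) that by blast
  have dX: "d k \<in> X" for k using R(1)[of 0 k] by simp
  have "\<exists>b. \<forall>l\<ge>b. (B ^^ l) (d k) = (\<lambda>v. 0)" for k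
  proof -
    obtain b where b: "\<forall>s\<in>(\<lambda>(i, q). i + q) ` {v. d k v \<noteq> 0}. s \<le> b"
      using finite_imageI[OF d(1)[of k], of "\<lambda>(i, q). i + q"]
      unfolding finite_nat_set_iff_bounded_le by (elim exE)
    have "(B ^^ l) (d k) = (\<lambda>v. 0)" if "l \<ge> b" for l
      using b that by (intro B_pow_eq_0[OF _ that dX]) force
    then show ?thesis by blast
  qed
  then obtain b where b: "\<And>k l. l \<ge> b k \<Longrightarrow> (B ^^ l) (d k) = (\<lambda>v. 0)" by metis
  \<comment> \<open>One exponent for two vectors: this is what later allows a common sequence
    \<open>s\<close> for both series.\<close>
  have small: "\<exists>l\<ge>M. N ((R ^^ l) (d k)) < e \<and> N ((R ^^ l) (d k')) < e" if "e > 0" for M k k' e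
  proof -
    have "\<forall>\<^sub>F j in sequentially. N ((R ^^ n j) (d k)) < e \<and> N ((R ^^ n j) (d k')) < e"
      using order_tendstoD(2)[OF R(2) that] by (intro eventually_conj) auto
    then obtain J where "\<And>j. j \<ge> J \<Longrightarrow> N ((R ^^ n j) (d k)) < e \<and> N ((R ^^ n j) (d k')) < e"
      unfolding eventually_sequentially by blast
    then show ?thesis
      using seq_suble[OF n(1), of "max M J"] by (intro exI[of _ "n (max M J)"]) auto
  qed
  \<comment> \<open>The third component makes every pair of targets recur infinitely often.\<close>
  define p where "p = (\<lambda>k. fst (prod_decode (fst (prod_decode k))))"
  define p' where "p' = (\<lambda>k. snd (prod_decode (fst (prod_decode k))))"
  define L where "L = (\<lambda>k. max (b (p k)) (b (p' k)))"
  define P where "P = (\<lambda>k l. N ((R ^^ l) (d (p k))) \<le> (1/2) ^ k \<and> N ((R ^^ l) (d (p' k))) \<le> (1/2) ^ k)"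
  have "\<exists>s. \<forall>k. P k (s k) \<and> (s (Suc k) \<ge> s k + L k \<and>
      C ^ s k * N ((R ^^ s (Suc k)) (d (p (Suc k)))) \<le> (1/2) ^ Suc k \<and>
      C ^ s k * N ((R ^^ s (Suc k)) (d (p' (Suc k)))) \<le> (1/2) ^ Suc k)"
  proof (rule dependent_nat_choice)
    show "\<exists>l. P 0 l" using small[of 1 0 "p 0" "p' 0"] by (auto simp: P_def intro: less_imp_le)
    fix l k
    have Cl: "C ^ l \<ge> 1" using C(1) by simp
    then have "(1/2) ^ Suc k / C ^ l > 0" by simp
    from small[OF this, of "l + L k" "p (Suc k)" "p' (Suc k)"] obtain l' where l': "l' \<ge> l + L k"
        "N ((R ^^ l') (d (p (Suc k)))) < (1/2) ^ Suc k / C ^ l"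
        "N ((R ^^ l') (d (p' (Suc k)))) < (1/2) ^ Suc k / C ^ l" by blast
    \<comment> \<open>As \<open>C ^ l \<ge> 1\<close>, the quotient bound yields both smallness
      conditions at once.\<close>
    have *: "C ^ l * z \<le> (1/2) ^ Suc k \<and> z \<le> (1/2) ^ Suc k"
      if "z < (1/2) ^ Suc k / C ^ l" "z \<ge> 0" for z
    proof -
      have "z * C ^ l < (1/2) ^ Suc k" using that(1) Cl by (subst (asm) pos_less_divide_eq) auto
      moreover have "z * 1 \<le> z * C ^ l" using that(2) Cl by (intro mult_left_mono)
      ultimately show ?thesis by (simp add: mult.commute)
    qed
    show "\<exists>l'. P (Suc k) l' \<and> (l' \<ge> l + L k \<and>
      C ^ l * N ((R ^^ l') (d (p (Suc k)))) \<le> (1/2) ^ Suc k \<and>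
      C ^ l * N ((R ^^ l') (d (p' (Suc k)))) \<le> (1/2) ^ Suc k)"
      using l'(1) *[OF l'(2) norm_nonneg[OF R(1)]] *[OF l'(3) norm_nonneg[OF R(1)]]
      unfolding P_def by blast
  qed
  then obtain s where s: "\<And>k. P k (s k)" "\<And>k. s (Suc k) \<ge> s k + L k"
      "\<And>k. C ^ s k * N ((R ^^ s (Suc k)) (d (p (Suc k)))) \<le> (1/2) ^ Suc k"
      "\<And>k. C ^ s k * N ((R ^^ s (Suc k)) (d (p' (Suc k)))) \<le> (1/2) ^ Suc k" by metis
  have "\<exists>x\<in>X. \<forall>k. N (\<lambda>v. (B ^^ s k) x v - d (p k) v) \<le> (1/2) ^ k"
    by (rule universal_series[where L = L]) (use s dV dX b R(1) in \<open>auto simp: P_def L_def\<close>)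
  then obtain x where x: "x \<in> X" "\<And>k. N (\<lambda>v. (B ^^ s k) x v - d (p k) v) \<le> (1/2) ^ k" by blast
  have "\<exists>x\<in>X. \<forall>k. N (\<lambda>v. (B ^^ s k) x v - d (p' k) v) \<le> (1/2) ^ k"
    by (rule universal_series[where L = L]) (use s dV dX b R(1) in \<open>auto simp: P_def L_def\<close>)
  then obtain x' where x': "x' \<in> X" "\<And>k. N (\<lambda>v. (B ^^ s k) x' v - d (p' k) v) \<le> (1/2) ^ k" by blast
  show ?thesis
  proof (rule weakly_mixingI[OF x(1) x'(1)])
    fix f f' :: "nat \<times> nat \<Rightarrow> complex" and r :: real
    assume f: "f \<in> X" "f' \<in> X" and r: "r > 0"
    obtain a where a: "N (\<lambda>v. d a v - f v) < r / 2" using d(3)[OF f(1), of "r / 2"] r by auto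
    obtain a' where a': "N (\<lambda>v. d a' v - f' v) < r / 2" using d(3)[OF f(2), of "r / 2"] r by auto
    obtain c where c: "(1/2) ^ c < r / 2" using real_arch_pow_inv[of "r / 2" "1/2"] r by auto
    \<comment> \<open>This index has targets \<open>a\<close> and \<open>a'\<close>, and it is at
      least \<open>c\<close>, so the error \<open>(1/2) ^ k\<close> is below
      \<open>r / 2\<close>.\<close>
    define k where "k = prod_encode (prod_encode (a, a'), c)"
    have p: "p k = a" "p' k = a'" by (simp_all add: p_def p'_def k_def)
    have "(1/2 :: real) ^ k \<le> (1/2) ^ c"
      unfolding k_def by (intro power_decreasing le_prod_encode_2) auto
    then have "N (\<lambda>v. (B ^^ s k) x v - d a v) < r / 2" "N (\<lambda>v. (B ^^ s k) x' v - d a' v) < r / 2"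
      using x(2)[of k] x'(2)[of k] c unfolding p by linarith+
    then have "N (\<lambda>v. (B ^^ s k) x v - f v) < r" "N (\<lambda>v. (B ^^ s k) x' v - f' v) < r"
      using norm_diff_triangle[OF B_pow_in_space[OF x(1)] dX f(1), of "s k" a] a
        norm_diff_triangle[OF B_pow_in_space[OF x'(1)] dX f(2), of "s k" a'] a' by linarith+
    then show "\<exists>n. (B ^^ n) x \<in> X \<and> (B ^^ n) x' \<in> X \<and>
        N (\<lambda>v. (B ^^ n) x v - f v) < r \<and> N (\<lambda>v. (B ^^ n) x' v - f' v) < r"
      using B_pow_in_space x(1) x'(1) by blast
  qed
qed

section \<open>The cycle of implications\<close>

text \<open>The implications run from weak mixing to hypercyclicity, then to the condition on single
  columns, then to the condition on all translates, and back to weak mixing.\<close>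

theorem equivalences:
  "(hypercyclic (norm_topology X N) B \<longleftrightarrow> weakly_mixing (norm_topology X N) B) \<and>
   (hypercyclic (norm_topology X N) B \<longleftrightarrow>
     (\<exists>n :: nat \<Rightarrow> nat. strict_mono n \<and> (\<forall>k. 0 < n k) \<and>
       (\<forall>i\<in>{1..m}. \<forall>j\<ge>1. (\<lambda>k. real (n k) ^ (m - i) * norm (\<mu> (i, j + n k))) \<longlonglongrightarrow> 0))) \<and>
   (hypercyclic (norm_topology X N) B \<longleftrightarrow>
     (\<exists>n :: nat \<Rightarrow> nat. strict_mono n \<and> (\<forall>k. 0 < n k) \<and>
       (\<forall>i\<in>{1..m}. (\<lambda>k. real (n k) ^ (m - i) * norm (\<mu> (i, n k))) \<longlonglongrightarrow> 0)))"
  (is "(?H \<longleftrightarrow> ?W) \<and> (?H \<longleftrightarrow> ?S) \<and> (?H \<longleftrightarrow> ?S1)")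
proof -
  have "?W \<Longrightarrow> ?H" by (rule weakly_mixing_imp_hypercyclic)
  moreover have "?S1" if ?H
  proof -
    have "\<exists>n. strict_mono n \<and> (\<forall>k. 0 < n k) \<and>
        (\<forall>k. \<forall>i\<in>{1..m}. real (n k) ^ (m - i) * norm (\<mu> (i, n k)) < inverse (Suc k))"
      by (intro strict_mono_choice necessity that) simp
    then obtain n where n: "strict_mono n" "\<And>k. 0 < n k"
      "\<And>k i. i \<in> {1..m} \<Longrightarrow> real (n k) ^ (m - i) * norm (\<mu> (i, n k)) < inverse (Suc k)" by blast
    have "(\<lambda>k. real (n k) ^ (m - i) * norm (\<mu> (i, n k))) \<longlonglongrightarrow> 0" if "i \<in> {1..m}" for i
      by (rule tendsto_0_if_less_inverse_Suc[of _ 0]) (use n(3) that in auto)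
    then show ?S1 using n(1,2) by blast
  qed
  moreover have "?S" if S1: ?S1
  proof -
    obtain n where n: "strict_mono n" "\<And>i. i \<in> {1..m} \<Longrightarrow>
        (\<lambda>k. real (n k) ^ (m - i) * norm (\<mu> (i, n k))) \<longlonglongrightarrow> 0" using S1 by blast
    have "\<exists>l\<ge>M. \<forall>i\<in>{1..m}. real l ^ (m - i) * norm (\<mu> (i, l)) < \<epsilon>" if "\<epsilon> > 0" for \<epsilon> M
    proof -
      have "\<forall>\<^sub>F k in sequentially. \<forall>i\<in>{1..m}. real (n k) ^ (m - i) * norm (\<mu> (i, n k)) < \<epsilon>"
        using order_tendstoD(2)[OF n(2) that] by (intro eventually_ball_finite) auto
      then obtain J where "\<And>k. k \<ge> J \<Longrightarrow>
          \<forall>i\<in>{1..m}. real (n k) ^ (m - i) * norm (\<mu> (i, n k)) < \<epsilon>"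
        unfolding eventually_sequentially by blast
      then show ?thesis
        using seq_suble[OF n(1), of "max M J"] by (intro exI[of _ "n (max M J)"]) auto
    qed
    \<comment> \<open>Diagonal choice: the index \<open>k\<close> takes care of the first
      \<open>k\<close> translates.\<close>
    then have "\<exists>n. strict_mono n \<and> (\<forall>k. 0 < n k) \<and>
        (\<forall>k. \<forall>i\<in>{1..m}. \<forall>j\<in>{1..k}. real (n k) ^ (m - i) * norm (\<mu> (i, j + n k)) < inverse (Suc k))"
      by (intro strict_mono_choice column_condition_shift) auto
    then obtain n' where n': "strict_mono n'" "\<And>k. 0 < n' k"
      "\<And>k i j. \<lbrakk>i \<in> {1..m}; j \<in> {1..k}\<rbrakk> \<Longrightarrow>
        real (n' k) ^ (m - i) * norm (\<mu> (i, j + n' k)) < inverse (Suc k)" by blast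
    have "(\<lambda>k. real (n' k) ^ (m - i) * norm (\<mu> (i, j + n' k))) \<longlonglongrightarrow> 0"
      if "i \<in> {1..m}" "j \<ge> 1" for i j
      by (rule tendsto_0_if_less_inverse_Suc[of _ j]) (use n'(3) that in auto)
    then show ?S using n'(1,2) by blast
  qed
  moreover have "?W" if ?S
    using that by (elim exE conjE) (rule sufficiency, auto)
  ultimately show ?thesis by argo
qed

end

theorem theorem2p1:
  fixes m :: nat
    and \<mu> :: "nat \<times> nat \<Rightarrow> complex"
    and X :: "(nat \<times> nat \<Rightarrow> complex) set"
    and N :: "(nat \<times> nat \<Rightarrow> complex) \<Rightarrow> real"
  assumes "m \<ge> 1"
    and "weight_on (grid_verts m) \<mu>"
    and "(\<exists>p\<ge>1. X = lp_space p (grid_verts m) \<mu> \<and> N = lp_norm p (grid_verts m) \<mu>) \<or>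
         (X = c0_space (grid_verts m) \<mu> \<and> N = c0_norm (grid_verts m) \<mu>)"
    and "bounded_operator_on X N (backward_shift (grid_edges m))"
  shows "(hypercyclic (norm_topology X N) (backward_shift (grid_edges m)) \<longleftrightarrow>
          weakly_mixing (norm_topology X N) (backward_shift (grid_edges m))) \<and>
         (hypercyclic (norm_topology X N) (backward_shift (grid_edges m)) \<longleftrightarrow>
          (\<exists>n :: nat \<Rightarrow> nat. strict_mono n \<and> (\<forall>k. 0 < n k) \<and>
             (\<forall>i\<in>{1..m}. \<forall>j\<ge>1.
                (\<lambda>k. real (n k) ^ (m - i) * norm (\<mu> (i, j + n k))) \<longlonglongrightarrow> 0))) \<and>
         (hypercyclic (norm_topology X N) (backward_shift (grid_edges m)) \<longleftrightarrow>
          (\<exists>n :: nat \<Rightarrow> nat. strict_mono n \<and> (\<forall>k. 0 < n k) \<and>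
             (\<forall>i\<in>{1..m}.
                (\<lambda>k. real (n k) ^ (m - i) * norm (\<mu> (i, n k))) \<longlonglongrightarrow> 0)))"
proof -
  have "complete_weighted_space (grid_verts m) \<mu> X N"
    using assms(3)
  proof (elim disjE exE conjE)
    fix p :: real assume "p \<ge> 1" "X = lp_space p (grid_verts m) \<mu>" "N = lp_norm p (grid_verts m) \<mu>"
    then show ?thesis
      using lp_setting.complete_weighted_space[of p "grid_verts m" \<mu>] assms(2)
      by (simp add: lp_setting_def)
  next
    assume "X = c0_space (grid_verts m) \<mu>" "N = c0_norm (grid_verts m) \<mu>"
    \<comment> \<open>The c0 norm is a supremum over the vertices, which must therefore exist;
      \<open>m \<ge> 1\<close> provides one.\<close>
    moreover have "grid_verts m \<noteq> {}" using assms(1) by (auto simp: grid_verts_def)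
    ultimately show ?thesis
      using c0_setting.complete_weighted_space[of "grid_verts m" \<mu>] assms(2)
      by (simp add: c0_setting_def)
  qed
  then interpret grid_shift m \<mu> X N
    using assms(1,4) by (simp add: grid_shift_def grid_shift_axioms_def)
  show ?thesis by (rule equivalences)
qed

end
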